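(* Let $m\ge 1$ and $k\ge 0$ be integers, and let $M_k(x_0,\underline x)$ be an $\mathbb R_{0,m}$-valued two-sided monogenic homogeneous polynomial of degree $k$ in $\mathbb R^{m+1}$. Then there exist polynomials $S_n(\underline x)\in\mathsf{M}_{l}(n)\cap\mathsf{M}_{r}(n)$, $n=0,\dots,k$, such that $$M_k(x_0,\underline x)=S_k(\underline x)+\sum_{\substack{n=1\\ n\ \mathrm{odd}}}^k\mathsf{CK}\Big[|\underline x|^{n-1}\big(\underline x\,S_{k-n}(\underline x)+S_{k-n}(\underline x)\,\underline x\big)\Big](x_0,\underline x)$$ $$\qquad+\sum_{\substack{n=2\\ n\ \mathrm{even}}}^k\ \sum_{\ell=0}^m\mathsf{CK}\Big[\lambda_{n,\ell}|\underline x|^{n}[S_{k-n}(\underline x)]_{\ell}+|\underline x|^{n-2}\,\underline x\,[S_{k-n}(\underline x)]_{\ell}\,\underline x\Big](x_0,\underline x),$$ where $\lambda_{n,\ell}=-\dfrac{2k+m-n-\mu_{\ell}}{n}$ and $\mu_\ell=(-1)^\ell(2\ell-m)$.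
   Context: $\mathbb R_{0,m}$ is the real Clifford algebra generated by the canonical basis $e_1,\dots,e_m$ of $\mathbb R^m$ with $e_je_k+e_ke_j=-2\delta_{jk}$. For $A=\{j_1<\dots<j_s\}\subset\{1,\dots,m\}$ put $e_A=e_{j_1}\cdots e_{j_s}$, $e_\emptyset=1$. The space of $\ell$-vectors is $\mathbb R_{0,m}^{(\ell)}=\mathrm{span}_{\mathbb R}(e_A:|A|=\ell)$, and $[a]_\ell$ denotes the projection of $a\in\mathbb R_{0,m}$ onto $\mathbb R_{0,m}^{(\ell)}$, so $a=\sum_{\ell=0}^m[a]_\ell$. A point of $\mathbb R^m$ is identified with $\underline x=\sum_{j=1}^m x_je_j$, so $\underline x^2=-|\underline x|^2$; points of $\mathbb R^{m+1}$ are written $(x_0,\underline x)$. The Dirac operator is $\partial_{\underline x}=\sum_{j=1}^me_j\partial_{x_j}$; it acts from the left by $\partial_{\underline x}f=\sum_je_j\,\partial_{x_j}f$ and from the right by $f\partial_{\underline x}=\sum_j(\partial_{x_j}f)\,e_j$. A continuously differentiable $\mathbb R_{0,m}$-valued function $f$ on an open subset of $\mathbb R^{m+1}$ is left (resp. right) monogenic if $(\partial_{x_0}+\partial_{\underline x})f=0$ (resp. $f(\partial_{x_0}+\partial_{\underline x})=\partial_{x_0}f+f\partial_{\underline x}=0$), and two-sided monogenic if it is both. On $\mathbb R^m$, left/right monogenic means $\partial_{\underline x}f=0$ / $f\partial_{\underline x}=0$. $\mathsf M_l(n)$ (resp. $\mathsf M_r(n)$) is the set of all left (resp. right) monogenic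 $\mathbb R_{0,m}$-valued homogeneous polynomials of degree $n$ in $\mathbb R^m$. For a polynomial $g(\underline x)$ on $\mathbb R^m$, its Cauchy-Kowalevski extension (the unique left monogenic extension to $\mathbb R^{m+1}$) is $\mathsf{CK}[g(\underline x)](x_0,\underline x)=\sum_{n=0}^\infty\frac{(-x_0)^n}{n!}\,\partial_{\underline x}^n g(\underline x)$ (a finite sum). *)

theory Defs
  imports "HOL-Analysis.Analysis"
begin

section \<open>The real Clifford algebra \<open>\<real>\<^bsub>0,m\<^esub>\<close>\<close>

text \<open>
  The type \<open>'n clifford\<close> is the real Clifford algebra with generators \<open>e\<^sub>j\<close> (\<open>j :: 'n\<close>), subject to
  \<open>e\<^sub>j e\<^sub>k + e\<^sub>k e\<^sub>j = - 2 \<delta>\<^sub>j\<^sub>k\<close>; so \<open>m = CARD('n)\<close>, and the linear order of \<open>'n\<close> is that of the indices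
  \<open>1 < \<dots> < m\<close>. An element is given by its coefficients with respect to the basis \<open>e\<^sub>A\<close>, \<open>A :: 'n set\<close>.
\<close>

typedef 'n clifford = "UNIV :: ('n set \<Rightarrow> real) set"
  morphisms coeff Abs_clifford
  by simp

lemma coeff_Abs [simp]: "coeff (Abs_clifford f) = f"
  by (simp add: Abs_clifford_inverse)

lemma clifford_eqI: "(\<And>A. coeff a A = coeff b A) \<Longrightarrow> a = b"
  by (metis coeff_inject ext)

lemma clifford_eq_iff: "a = b \<longleftrightarrow> (\<forall>A. coeff a A = coeff b A)"
  by (auto intro: clifford_eqI)

instantiation clifford :: (type) real_vector
begin

definition "0 = Abs_clifford (\<lambda>A. 0)"
definition "a + b = Abs_clifford (\<lambda>A. coeff a A + coeff b A)"
definition "a - b = Abs_clifford (\<lambda>A. coeff a A - coeff b A)"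
definition "- a = Abs_clifford (\<lambda>A. - coeff a A)"
definition "r *\<^sub>R a = Abs_clifford (\<lambda>A. r * coeff a A)"

instance
  by standard
    (auto simp: clifford_eq_iff zero_clifford_def plus_clifford_def minus_clifford_def
      uminus_clifford_def scaleR_clifford_def algebra_simps)

end

lemma coeff_zero [simp]: "coeff 0 A = 0"
  by (simp add: zero_clifford_def)

lemma coeff_add [simp]: "coeff (a + b) A = coeff a A + coeff b A"
  by (simp add: plus_clifford_def)

lemma coeff_diff [simp]: "coeff (a - b) A = coeff a A - coeff b A"
  by (simp add: minus_clifford_def)

lemma coeff_minus [simp]: "coeff (- a) A = - coeff a A"
  by (simp add: uminus_clifford_def)

lemma coeff_scaleR [simp]: "coeff (r *\<^sub>R a) A = r * coeff a A"
  by (simp add: scaleR_clifford_def)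

lemma coeff_sum [simp]: "coeff (sum f I) A = (\<Sum>i\<in>I. coeff (f i) A)"
  by (induction I rule: infinite_finite_induct) auto

definition ebasis :: "'n set \<Rightarrow> 'n clifford"
  where "ebasis A = Abs_clifford (\<lambda>B. if B = A then 1 else 0)"

lemma coeff_ebasis: "coeff (ebasis A) B = (if B = A then 1 else 0)"
  by (simp add: ebasis_def)

lemma ebasis_eq_iff: "ebasis A = ebasis B \<longleftrightarrow> A = B"
  by (metis coeff_ebasis zero_neq_one)

abbreviation egen :: "'n \<Rightarrow> 'n clifford"
  where "egen j \<equiv> ebasis {j}"

text \<open>The Euclidean structure for which the \<open>e\<^sub>A\<close> are orthonormal; it only serves to give a meaning to
  limits and derivatives.\<close>

instantiation clifford :: (finite) euclidean_space
begin

definition inner_clifford :: "'a clifford \<Rightarrow> 'a clifford \<Rightarrow> real"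
  where "inner_clifford a b = (\<Sum>A\<in>UNIV. coeff a A * coeff b A)"
definition norm_clifford :: "'a clifford \<Rightarrow> real"
  where "norm_clifford a = sqrt (inner a a)"
definition sgn_clifford :: "'a clifford \<Rightarrow> 'a clifford"
  where "sgn_clifford a = a /\<^sub>R norm a"
definition dist_clifford :: "'a clifford \<Rightarrow> 'a clifford \<Rightarrow> real"
  where "dist_clifford a b = norm (a - b)"
definition uniformity_clifford :: "('a clifford \<times> 'a clifford) filter"
  where "uniformity_clifford = (INF e\<in>{0 <..}. principal {(a, b). dist a b < e})"
definition open_clifford :: "'a clifford set \<Rightarrow> bool"
  where "open_clifford U \<longleftrightarrow> (\<forall>x\<in>U. eventually (\<lambda>(x', y). x' = x \<longrightarrow> y \<in> U) uniformity)"
definition Basis_clifford :: "'a clifford set"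
  where "Basis_clifford = range ebasis"

instance
proof
  fix a b c :: "'a clifford" and r :: real
  show "inner a b = inner b a"
    by (simp add: inner_clifford_def mult.commute)
  show "inner (a + b) c = inner a c + inner b c"
    by (simp add: inner_clifford_def algebra_simps sum.distrib)
  show "inner (r *\<^sub>R a) b = r * inner a b"
    by (simp add: inner_clifford_def algebra_simps sum_distrib_left)
  show "0 \<le> inner a a"
    by (simp add: inner_clifford_def sum_nonneg)
  show "inner a a = 0 \<longleftrightarrow> a = 0"
    by (simp add: inner_clifford_def sum_nonneg_eq_0_iff clifford_eq_iff)
  show "(\<forall>u\<in>Basis. inner a u = 0) \<longleftrightarrow> a = 0"
    by (simp add: Basis_clifford_def inner_clifford_def coeff_ebasis clifford_eq_iff if_distrib
        cong: if_cong)
next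
  fix u v :: "'a clifford"
  assume "u \<in> Basis" "v \<in> Basis"
  then obtain A B where "u = ebasis A" "v = ebasis B"
    by (auto simp: Basis_clifford_def)
  moreover have "(\<Sum>X\<in>UNIV. coeff (ebasis A) X * coeff (ebasis B) X)
      = (\<Sum>X\<in>UNIV. if X = A then (if A = B then 1 else 0) else 0)"
    by (intro sum.cong refl) (auto simp: coeff_ebasis)
  ultimately show "inner u v = (if u = v then 1 else 0)"
    by (simp add: inner_clifford_def ebasis_eq_iff)
qed (simp_all add: norm_clifford_def sgn_clifford_def dist_clifford_def uniformity_clifford_def
    open_clifford_def Basis_clifford_def)

end

text \<open>Sorting the word \<open>e\<^sub>A e\<^sub>B\<close> costs a sign for each pair \<open>(a, b) \<in> A \<times> B\<close> with \<open>b < a\<close> (transposition)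
  and one for each \<open>a = b\<close> (because \<open>e\<^sub>a\<^sup>2 = - 1\<close>).\<close>

definition esign :: "'n::linorder set \<Rightarrow> 'n set \<Rightarrow> real"
  where "esign A B = (\<Prod>a\<in>A. \<Prod>b\<in>B. if b \<le> a then - 1 else 1)"

lemma prod_sym_diff:
  fixes f :: "'a::finite \<Rightarrow> real"
  assumes "\<And>x. f x * f x = 1"
  shows "prod f (sym_diff A B) = prod f A * prod f B"
proof -
  have 1: "prod f A = prod f (A - B) * prod f (A \<inter> B)" for A B :: "'a set"
    using prod.Int_Diff[of A f B] by (simp add: mult.commute)
  have 2: "prod f (A \<inter> B) * prod f (B \<inter> A) = 1"
    by (simp add: Int_commute assms flip: prod.distrib)
  have "prod f (sym_diff A B) = prod f (A - B) * prod f (B - A)"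
    by (rule prod.union_disjoint) auto
  also have "\<dots> = prod f (A - B) * prod f (B - A) * (prod f (A \<inter> B) * prod f (B \<inter> A))"
    using 2 by simp
  also have "\<dots> = prod f A * prod f B"
    using 1[of A B] 1[of B A] by simp
  finally show ?thesis .
qed

lemma esign_square: "esign A B * esign A B = 1"
  unfolding esign_def by (auto simp flip: prod.distrib intro!: prod.neutral)

lemma esign_sym_diff_left:
  "esign (sym_diff A B) (C :: 'n::{finite,linorder} set) = esign A C * esign B C"
  unfolding esign_def by (rule prod_sym_diff) (auto simp flip: prod.distrib intro!: prod.neutral)

lemma esign_sym_diff_right:
  "esign A (sym_diff B C :: 'n::{finite,linorder} set) = esign A B * esign A C"
  unfolding esign_def by (subst prod_sym_diff) (auto simp: prod.distrib)

lemma esign_empty [simp]: "esign {} A = 1" "esign A {} = 1"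
  by (simp_all add: esign_def)

lemma sym_diff_cancel [simp]: "sym_diff A (sym_diff A B) = B"
  by blast

lemma sym_diff_cancel2 [simp]: "sym_diff (sym_diff B A) (sym_diff B C) = sym_diff A C"
  by blast

instantiation clifford :: ("{finite,linorder}") ring_1
begin

definition "1 = ebasis {}"
definition "a * b = Abs_clifford (\<lambda>C. \<Sum>A\<in>UNIV.
  esign A (sym_diff A C) * coeff a A * coeff b (sym_diff A C))"

instance
proof
  fix a b c :: "'a clifford"
  have coeff_times: "coeff (a * b) C =
      (\<Sum>A\<in>UNIV. esign A (sym_diff A C) * coeff a A * coeff b (sym_diff A C))" for a b :: "'a clifford" and C
    by (simp add: times_clifford_def)
  show "(a + b) * c = a * c + b * c" "a * (b + c) = a * b + a * c"
    by (simp_all add: clifford_eq_iff coeff_times algebra_simps sum.distrib)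
  have "coeff (1 * a) C = coeff a C" for C
  proof -
    have "coeff (1 * a) C = (\<Sum>A\<in>UNIV. if A = ({} :: 'a set) then coeff a C else 0)"
      unfolding coeff_times one_clifford_def by (intro sum.cong refl) (auto simp: coeff_ebasis)
    then show ?thesis by simp
  qed
  then show "1 * a = a" by (simp add: clifford_eq_iff)
  have "coeff (a * 1) C = coeff a C" for C
  proof -
    have "coeff (a * 1) C = (\<Sum>A\<in>UNIV. if A = C then coeff a C else 0)"
      unfolding coeff_times one_clifford_def by (intro sum.cong refl) (auto simp: coeff_ebasis)
    then show ?thesis by simp
  qed
  then show "a * 1 = a" by (simp add: clifford_eq_iff)
  show "(0::'a clifford) \<noteq> 1"
    by (auto simp: clifford_eq_iff one_clifford_def coeff_ebasis)
  have "coeff (a * b * c) D = coeff (a * (b * c)) D" for D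
  proof -
    have bij: "bij_betw (sym_diff B) UNIV UNIV" for B :: "'a set"
      by (rule bij_betwI[where g = "sym_diff B"]) auto
    have sg: "esign A (sym_diff A D) * esign B (sym_diff B A)
        = esign B (sym_diff B D) * esign (sym_diff B A) (sym_diff A D)" for A B :: "'a set"
    proof -
      have eq: "sym_diff B D = sym_diff (sym_diff B A) (sym_diff A D)" by blast
      have "esign B (sym_diff B D) = esign B (sym_diff B A) * esign B (sym_diff A D)"
        by (subst eq) (rule esign_sym_diff_right)
      moreover have "esign (sym_diff B A) (sym_diff A D)
          = esign B (sym_diff A D) * esign A (sym_diff A D)"
        by (rule esign_sym_diff_left)
      ultimately show ?thesis
        using esign_square[of B "sym_diff A D"] by algebra
    qed
    have "coeff (a * b * c) D = (\<Sum>A\<in>UNIV. \<Sum>B\<in>UNIV.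
        (esign A (sym_diff A D) * esign B (sym_diff B A))
          * (coeff a B * coeff b (sym_diff B A) * coeff c (sym_diff A D)))"
      unfolding coeff_times by (simp only: sum_distrib_left sum_distrib_right mult_ac)
    also have "\<dots> = (\<Sum>B\<in>UNIV. \<Sum>A\<in>UNIV.
        (esign B (sym_diff B D) * esign (sym_diff B A) (sym_diff A D))
          * (coeff a B * coeff b (sym_diff B A) * coeff c (sym_diff A D)))"
      by (subst sum.swap) (simp only: sg)
    also have "\<dots> = (\<Sum>B\<in>UNIV. esign B (sym_diff B D) * coeff a B * (\<Sum>A\<in>UNIV.
        esign (sym_diff B A) (sym_diff (sym_diff B A) (sym_diff B D))
          * coeff b (sym_diff B A) * coeff c (sym_diff (sym_diff B A) (sym_diff B D))))"
      by (simp only: sym_diff_cancel2 sum_distrib_left mult_ac)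
    also have "\<dots> = coeff (a * (b * c)) D"
      unfolding coeff_times
      by (intro sum.cong refl arg_cong2[where f = "(*)"] sum.reindex_bij_betw bij)
    finally show ?thesis .
  qed
  then show "a * b * c = a * (b * c)"
    by (simp add: clifford_eq_iff)
qed

end

lemma coeff_times:
  "coeff (a * b) C = (\<Sum>A\<in>UNIV. esign A (sym_diff A C) * coeff a A * coeff b (sym_diff A C))"
  for a b :: "'n::{finite,linorder} clifford"
  by (simp add: times_clifford_def)

instance clifford :: ("{finite,linorder}") real_algebra_1
  by standard (auto simp: clifford_eq_iff coeff_times sum_distrib_left algebra_simps)

text \<open>The following facts show that this is the Clifford algebra, with its usual basis.\<close>

lemma ebasis_mult:
  "ebasis A * ebasis B = esign A B *\<^sub>R ebasis (sym_diff A B :: 'n::{finite,linorder} set)"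
proof (rule clifford_eqI)
  fix C :: "'n set"
  have "coeff (ebasis A * ebasis B) C =
      (\<Sum>X\<in>UNIV. if X = A then (if sym_diff A C = B then esign A B else 0) else 0)"
    unfolding coeff_times by (intro sum.cong refl) (auto simp: coeff_ebasis)
  moreover have "sym_diff A C = B \<longleftrightarrow> C = sym_diff A B" by blast
  ultimately show "coeff (ebasis A * ebasis B) C = coeff (esign A B *\<^sub>R ebasis (sym_diff A B)) C"
    by (simp add: coeff_ebasis)
qed

lemma egen_anticommute:
  fixes j k :: "'n::{finite,linorder}"
  shows "egen j * egen k + egen k * egen j = (if j = k then - 2 else 0)"
proof (cases "j = k")
  case True
  have "egen k * egen k = - 1"
    by (simp add: ebasis_mult esign_def one_clifford_def)
  with True show ?thesis by simp
next
  case False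
  then have "sym_diff {j} {k} = sym_diff {k} {j}" by blast
  with False show ?thesis
    by (auto simp: ebasis_mult esign_def simp flip: scaleR_add_left)
qed

lemma ebasis_eq_prod_list:
  "ebasis (A :: 'n::{finite,linorder} set) = prod_list (map egen (sorted_list_of_set A))"
proof -
  have "ebasis (set xs) = prod_list (map egen xs)"
    if "sorted xs" "distinct xs" for xs :: "'n list"
    using that
  proof (induction xs)
    case Nil
    show ?case by (simp add: one_clifford_def)
  next
    case (Cons x xs)
    have "esign {x} (set xs) = 1"
      using Cons.prems by (auto simp: esign_def intro!: prod.neutral)
    moreover have "sym_diff {x} (set xs) = set (x # xs)"
      using Cons.prems by auto
    ultimately have "ebasis (set (x # xs)) = egen x * ebasis (set xs)"
      by (simp add: ebasis_mult)
    with Cons show ?case by simp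
  qed
  from this[of "sorted_list_of_set A"] show ?thesis by simp
qed

lemma clifford_eq_sum_ebasis: "a = (\<Sum>A\<in>UNIV. coeff a A *\<^sub>R ebasis (A :: 'n::finite set))"
  by (rule clifford_eqI) (simp add: coeff_ebasis if_distrib cong: if_cong)

text \<open>Projection \<open>[a]\<^sub>l\<close> onto the \<open>l\<close>-vectors.\<close>

definition grade :: "nat \<Rightarrow> 'n clifford \<Rightarrow> 'n clifford"
  where "grade l a = (\<Sum>A | card A = l. coeff a A *\<^sub>R ebasis A)"

lemma sum_grade: "(\<Sum>l\<le>CARD('n). grade l a) = (a :: 'n::finite clifford)"
proof -
  have "(\<Sum>l\<le>CARD('n). grade l a) = (\<Sum>l\<le>CARD('n). \<Sum>A | A \<in> UNIV \<and> card A = l. coeff a A *\<^sub>R ebasis A)"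
    by (simp add: grade_def)
  also have "\<dots> = (\<Sum>A\<in>UNIV. coeff a A *\<^sub>R ebasis A)"
    by (rule sum.group) (auto simp: card_mono)
  finally show ?thesis by (simp flip: clifford_eq_sum_ebasis)
qed

text \<open>Identification of a point of \<open>real^'n\<close> with a 1-vector.\<close>

definition cvec :: "real^'n \<Rightarrow> 'n::finite clifford"
  where "cvec x = (\<Sum>j\<in>UNIV. (x $ j) *\<^sub>R egen j)"

lemma cvec_square: "cvec x * cvec x = - ((norm x)\<^sup>2 *\<^sub>R (1 :: 'n::{finite,linorder} clifford))"
proof -
  let ?p = "\<lambda>j k. (x $ j * x $ k) *\<^sub>R (egen j * egen k)"
  have sq: "cvec x * cvec x = (\<Sum>j\<in>UNIV. \<Sum>k\<in>UNIV. ?p j k)"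
    by (simp add: cvec_def sum_product mult.commute)
  have "(\<Sum>j\<in>UNIV. \<Sum>k\<in>UNIV. ?p j k) + (\<Sum>j\<in>UNIV. \<Sum>k\<in>UNIV. ?p k j)
      = (\<Sum>j\<in>UNIV. \<Sum>k\<in>UNIV. (x $ j * x $ k) *\<^sub>R (egen j * egen k + egen k * egen j))"
    by (simp only: sum.distrib scaleR_add_right mult.commute)
  also have "\<dots> = (\<Sum>j\<in>UNIV. \<Sum>k\<in>UNIV. if j = k then (x $ j * x $ j) *\<^sub>R (- 2) else 0)"
    by (intro sum.cong refl) (auto simp: egen_anticommute)
  also have "\<dots> = (\<Sum>j\<in>UNIV. x $ j * x $ j) *\<^sub>R (- 2)"
    by (simp add: scaleR_sum_left sum_negf)
  also have "(\<Sum>j\<in>UNIV. x $ j * x $ j) = (norm x)\<^sup>2"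
    by (simp add: power2_norm_eq_inner inner_vec_def)
  finally have *: "(\<Sum>j\<in>UNIV. \<Sum>k\<in>UNIV. ?p j k) + (\<Sum>j\<in>UNIV. \<Sum>k\<in>UNIV. ?p k j)
      = (norm x)\<^sup>2 *\<^sub>R (- 2)" .
  have "2 *\<^sub>R (cvec x * cvec x) = (\<Sum>j\<in>UNIV. \<Sum>k\<in>UNIV. ?p j k) + (\<Sum>j\<in>UNIV. \<Sum>k\<in>UNIV. ?p k j)"
    unfolding scaleR_2 sq by (rule arg_cong2[OF refl sum.swap])
  also have "\<dots> = (norm x)\<^sup>2 *\<^sub>R (- (2 *\<^sub>R 1))"
    unfolding * scaleR_2 by (rule arg_cong) simp
  also have "\<dots> = 2 *\<^sub>R (- ((norm x)\<^sup>2 *\<^sub>R (1 :: 'n clifford)))"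
    by (simp only: scaleR_minus_right scaleR_left_commute)
  finally show ?thesis
    by (simp only: real_vector.scale_cancel_left) simp
qed

section \<open>Dirac operator and monogenic functions\<close>

definition partial :: "'n \<Rightarrow> (real^'n \<Rightarrow> 'b::real_normed_vector) \<Rightarrow> real^'n \<Rightarrow> 'b"
  where "partial j f x = vector_derivative (\<lambda>t. f (x + t *\<^sub>R axis j 1)) (at 0)"

definition dirac_left ::
  "(real^'n::{finite,linorder} \<Rightarrow> 'n clifford) \<Rightarrow> real^'n::{finite,linorder} \<Rightarrow> 'n clifford"
  where "dirac_left f x = (\<Sum>j\<in>UNIV. egen j * partial j f x)"

definition dirac_right ::
  "(real^'n::{finite,linorder} \<Rightarrow> 'n clifford) \<Rightarrow> real^'n::{finite,linorder} \<Rightarrow> 'n clifford"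
  where "dirac_right f x = (\<Sum>j\<in>UNIV. partial j f x * egen j)"

definition C1_on :: "'a::real_normed_vector set \<Rightarrow> ('a \<Rightarrow> 'b::real_normed_vector) \<Rightarrow> bool"
  where "C1_on \<Omega> f \<longleftrightarrow> (\<exists>f' :: 'a \<Rightarrow> 'a \<Rightarrow>\<^sub>L 'b.
    (\<forall>x\<in>\<Omega>. (f has_derivative blinfun_apply (f' x)) (at x)) \<and> continuous_on \<Omega> f')"

text \<open>Points of \<open>\<real>\<^bsup>m+1\<^esup>\<close> are pairs \<open>(x\<^sub>0, x)\<close> of type \<open>real \<times> (real^'n)\<close>.\<close>

definition left_monogenic_on ::
  "(real \<times> (real^'n::{finite,linorder})) set \<Rightarrow>
    (real \<times> (real^'n::{finite,linorder}) \<Rightarrow> 'n clifford) \<Rightarrow> bool"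
  where "left_monogenic_on \<Omega> f \<longleftrightarrow> open \<Omega> \<and> C1_on \<Omega> f \<and>
    (\<forall>(x0, x)\<in>\<Omega>. vector_derivative (\<lambda>t. f (t, x)) (at x0) + dirac_left (\<lambda>y. f (x0, y)) x = 0)"

definition right_monogenic_on ::
  "(real \<times> (real^'n::{finite,linorder})) set \<Rightarrow>
    (real \<times> (real^'n::{finite,linorder}) \<Rightarrow> 'n clifford) \<Rightarrow> bool"
  where "right_monogenic_on \<Omega> f \<longleftrightarrow> open \<Omega> \<and> C1_on \<Omega> f \<and>
    (\<forall>(x0, x)\<in>\<Omega>. vector_derivative (\<lambda>t. f (t, x)) (at x0) + dirac_right (\<lambda>y. f (x0, y)) x = 0)"

definition two_sided_monogenic_on ::
  "(real \<times> (real^'n::{finite,linorder})) set \<Rightarrow>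
    (real \<times> (real^'n::{finite,linorder}) \<Rightarrow> 'n clifford) \<Rightarrow> bool"
  where "two_sided_monogenic_on \<Omega> f \<longleftrightarrow> left_monogenic_on \<Omega> f \<and> right_monogenic_on \<Omega> f"

text \<open>As usual, the zero polynomial is homogeneous of every degree.\<close>

definition homogeneous_polynomial ::
  "nat \<Rightarrow> ('a::real_normed_vector \<Rightarrow> 'b::real_normed_vector) \<Rightarrow> bool"
  where "homogeneous_polynomial k f \<longleftrightarrow>
    polynomial_function f \<and> (\<forall>c x. f (c *\<^sub>R x) = c ^ k *\<^sub>R f x)"

definition left_monogenic_polys ::
  "nat \<Rightarrow> (real^'n::{finite,linorder} \<Rightarrow> 'n clifford) set"
  where "left_monogenic_polys n = {f. homogeneous_polynomial n f \<and> (\<forall>x. dirac_left f x = 0)}"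

definition right_monogenic_polys ::
  "nat \<Rightarrow> (real^'n::{finite,linorder} \<Rightarrow> 'n clifford) set"
  where "right_monogenic_polys n = {f. homogeneous_polynomial n f \<and> (\<forall>x. dirac_right f x = 0)}"

text \<open>The Cauchy-Kowalevski extension; for polynomials \<open>g\<close> the series terminates.\<close>

definition CK ::
  "(real^'n::{finite,linorder} \<Rightarrow> 'n clifford) \<Rightarrow> real \<Rightarrow> real^'n::{finite,linorder} \<Rightarrow> 'n clifford"
  where "CK g x0 x = (\<Sum>n. ((- x0) ^ n / fact n) *\<^sub>R (dirac_left ^^ n) g x)"

text \<open>In \<open>mu\<close> and \<open>lam\<close> the first argument is the dimension \<open>m\<close>.\<close>

definition mu :: "nat \<Rightarrow> nat \<Rightarrow> real"
  where "mu m l = (- 1) ^ l * (2 * real l - real m)"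

definition lam :: "nat \<Rightarrow> nat \<Rightarrow> nat \<Rightarrow> nat \<Rightarrow> real"
  where "lam m k n l = - ((2 * real k + real m - real n - mu m l) / real n)"

end

theory Submission
  imports Defs
begin

text \<open>
  A left monogenic polynomial is the Cauchy-Kowalevski extension of its restriction \<open>P\<close> to \<open>x\<^sub>0 = 0\<close>, and
  two-sidedness of \<open>M\<close> means \<open>\<partial>P = P\<partial>\<close>. This property is inherited by \<open>\<partial>P\<close>, so one can argue by induction on
  the degree. Let \<open>T\<^sub>n S\<close> be the \<open>n\<close>-th term of the expansion before extension. For two-sided monogenic \<open>S\<close> of
  degree \<open>j\<close> the identity \<open>\<Sum>\<^sub>i e\<^sub>i [a]\<^sub>l e\<^sub>i = \<mu>\<^sub>l [a]\<^sub>l\<close> gives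
  \<open>\<partial>(T\<^sub>n S) = (T\<^sub>n S)\<partial> = c T\<^bsub>n-1\<^esub> S\<close> with \<open>c = - (2j + n + m)\<close> for even \<open>n\<close> and \<open>c = n - 1\<close> for odd \<open>n \<ge> 3\<close>, and
  \<open>\<partial>(T\<^sub>1 S) = \<Sum>\<^sub>l (\<mu>\<^sub>l - m - 2j) [S]\<^sub>l\<close>. The value of \<open>\<lambda>\<^bsub>n,l\<^esub>\<close> is exactly the one for which the left and right
  derivatives agree. Hence the expansion of \<open>\<partial>P\<close> lifts term by term, and the remainder is two-sided monogenic.
\<close>

section \<open>Partial derivatives of polynomials\<close>

lemma inner_ebasis: "inner a (ebasis A) = coeff a (A :: 'n::finite set)"
  by (simp add: inner_clifford_def coeff_ebasis if_distrib cong: if_cong)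

lemma bounded_linear_coeff: "bounded_linear (\<lambda>a :: 'n::finite clifford. coeff a A)"
  using bounded_linear_inner_left[of "ebasis A"] by (simp add: inner_ebasis)

text \<open>In finite dimension bilinearity alone gives boundedness, so the product rule applies
  without a norm estimate for the Clifford product.\<close>

lemma bounded_bilinear_clifford_times:
  "bounded_bilinear ((*) :: 'n::{finite,linorder} clifford \<Rightarrow> _)"
  by (subst bilinear_conv_bounded_bilinear[symmetric])
    (auto simp: bilinear_def algebra_simps intro!: linearI)

lemmas bounded_linear_clifford_mult_right =
  bounded_bilinear.bounded_linear_right[OF bounded_bilinear_clifford_times]

lemmas bounded_linear_clifford_mult_left =
  bounded_bilinear.bounded_linear_left[OF bounded_bilinear_clifford_times]

lemma polynomial_function_clifford_iff:
  fixes f :: "'a::euclidean_space \<Rightarrow> 'n::finite clifford"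
  shows "polynomial_function f \<longleftrightarrow> (\<forall>A. real_polynomial_function (\<lambda>x. coeff (f x) A))"
  by (simp add: polynomial_function_iff_Basis_inner Basis_clifford_def inner_ebasis)

lemma polynomial_function_linear_image:
  fixes f :: "'a::euclidean_space \<Rightarrow> 'b::real_normed_vector" and g :: "'b \<Rightarrow> 'c::real_normed_vector"
  assumes "polynomial_function f" "bounded_linear g"
  shows "polynomial_function (\<lambda>x. g (f x))"
  using polynomial_function_compose[OF assms(1) polynomial_function_bounded_linear[OF assms(2)]]
  by (simp add: o_def)

lemma polynomial_function_clifford_times:
  fixes f g :: "'a::euclidean_space \<Rightarrow> 'n::{finite,linorder} clifford"
  assumes "polynomial_function f" "polynomial_function g"
  shows "polynomial_function (\<lambda>x. f x * g x)"
  using assms unfolding polynomial_function_clifford_iff coeff_times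
  by (auto intro!: real_polynomial_function_sum real_polynomial_function.intros(2,4))

lemma polynomial_function_scaleR:
  fixes f :: "'a::euclidean_space \<Rightarrow> 'n::finite clifford"
  assumes "real_polynomial_function q" "polynomial_function f"
  shows "polynomial_function (\<lambda>x. q x *\<^sub>R f x)"
  using assms unfolding polynomial_function_clifford_iff
  by (auto intro!: real_polynomial_function.intros(4))

section \<open>Calculus of partial derivatives\<close>

lemma has_vector_derivative_partial:
  fixes f :: "real^'n::finite \<Rightarrow> 'b::real_normed_vector"
  assumes "f differentiable (at x)"
  shows "((\<lambda>t. f (x + t *\<^sub>R axis j 1)) has_vector_derivative partial j f x) (at 0)"
proof -
  have "f differentiable (at (x + 0 *\<^sub>R axis j 1))"
    using assms by simp
  moreover have "(\<lambda>t. x + t *\<^sub>R axis j (1 :: real)) differentiable (at 0)"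
    by (auto simp: differentiable_def intro!: exI derivative_eq_intros)
  ultimately have "(f \<circ> (\<lambda>t. x + t *\<^sub>R axis j 1)) differentiable (at 0)"
    by (intro differentiable_chain_at) auto
  then show ?thesis
    by (simp add: vector_derivative_works partial_def o_def)
qed

lemma partial_eqI:
  "((\<lambda>t. f (x + t *\<^sub>R axis j 1)) has_vector_derivative d) (at 0) \<Longrightarrow> partial j f x = d"
  by (simp add: partial_def vector_derivative_at)

lemma partial_bounded_linear:
  fixes f :: "real^'n::finite \<Rightarrow> 'b::real_normed_vector"
  assumes "bounded_linear L" "f differentiable (at x)"
  shows "partial j (\<lambda>y. L (f y)) x = L (partial j f x)"
  by (intro partial_eqI bounded_linear.has_vector_derivative[OF assms(1)]
      has_vector_derivative_partial assms)

lemma partial_bilinear: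
  fixes f :: "real^'n::finite \<Rightarrow> 'b::real_normed_vector" and g :: "real^'n \<Rightarrow> 'c::real_normed_vector"
  assumes "bounded_bilinear h" "f differentiable (at x)" "g differentiable (at x)"
  shows "partial j (\<lambda>y. h (f y) (g y)) x = h (f x) (partial j g x) + h (partial j f x) (g x)"
  using bounded_bilinear.has_vector_derivative[OF assms(1)
      has_vector_derivative_partial[OF assms(2), of j] has_vector_derivative_partial[OF assms(3), of j]]
  by (intro partial_eqI) simp

lemma partial_const [simp]: "partial j (\<lambda>x. c) x = 0"
  by (simp add: partial_def)

lemma partial_add:
  fixes f g :: "real^'n::finite \<Rightarrow> 'b::real_normed_vector"
  assumes "f differentiable (at x)" "g differentiable (at x)"
  shows "partial j (\<lambda>y. f y + g y) x = partial j f x + partial j g x"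
  by (intro partial_eqI has_vector_derivative_add has_vector_derivative_partial assms)

lemma partial_sum:
  fixes f :: "'i \<Rightarrow> real^'n::finite \<Rightarrow> 'b::real_normed_vector"
  assumes "\<And>i. i \<in> I \<Longrightarrow> f i differentiable (at x)"
  shows "partial j (\<lambda>y. \<Sum>i\<in>I. f i y) x = (\<Sum>i\<in>I. partial j (f i) x)"
  by (intro partial_eqI has_vector_derivative_sum has_vector_derivative_partial assms)

lemma coeff_partial:
  fixes f :: "real^'n::finite \<Rightarrow> 'm::finite clifford"
  assumes "f differentiable (at x)"
  shows "coeff (partial j f x) A = partial j (\<lambda>y. coeff (f y) A) x"
  by (rule partial_bounded_linear[OF bounded_linear_coeff assms, symmetric])

lemma partial_of_bounded_linear:
  assumes "bounded_linear L"
  shows "partial j L = (\<lambda>x. L (axis j 1))"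
proof
  fix x
  interpret bounded_linear L by fact
  show "partial j L x = L (axis j 1)"
    by (intro partial_eqI) (auto simp: add scaleR intro!: derivative_eq_intros)
qed

lemma real_polynomial_function_partial:
  fixes f :: "real^'n::finite \<Rightarrow> real"
  assumes "real_polynomial_function f"
  shows "real_polynomial_function (partial j f)"
  using assms
proof induction
  case (linear f)
  then show ?case
    by (simp add: partial_of_bounded_linear real_polynomial_function.intros(2))
next
  case (const c)
  have "partial j (\<lambda>x. c :: real) = (\<lambda>x. 0)"
    by (simp add: fun_eq_iff)
  then show ?case by (simp add: real_polynomial_function.intros(2))
next
  case (add f g)
  then have "partial j (\<lambda>x. f x + g x) = (\<lambda>x. partial j f x + partial j g x)"
    by (intro ext partial_add differentiable_at_real_polynomial_function)
  with add show ?case by (auto intro: real_polynomial_function.intros(3))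
next
  case (mult f g)
  then have "partial j (\<lambda>x. f x * g x) = (\<lambda>x. f x * partial j g x + partial j f x * g x)"
    by (intro ext partial_bilinear bounded_bilinear_mult differentiable_at_real_polynomial_function)
  with mult show ?case by (auto intro!: real_polynomial_function.intros(3,4))
qed

lemma polynomial_function_partial:
  fixes f :: "real^'n::finite \<Rightarrow> 'm::finite clifford"
  assumes "polynomial_function f"
  shows "polynomial_function (partial j f)"
  using assms unfolding polynomial_function_clifford_iff
  by (simp add: coeff_partial differentiable_at_polynomial_function assms real_polynomial_function_partial)

text \<open>Structural induction on the polynomial replaces an analytic argument: linear maps have
  constant partials, and in the product case both sides expand into the same four terms.\<close>

lemma real_partial_commute:
  fixes f :: "real^'n::finite \<Rightarrow> real"
  assumes "real_polynomial_function f"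
  shows "partial i (partial j f) x = partial j (partial i f) x"
  using assms
proof (induction arbitrary: x)
  case (linear f)
  then show ?case
    by (simp add: partial_of_bounded_linear)
next
  case (const c)
  have "partial j (\<lambda>x. c :: real) = (\<lambda>x. 0)" for j :: 'n
    by (simp add: fun_eq_iff)
  then show ?case by simp
next
  case (add f g)
  note d = differentiable_at_real_polynomial_function
  from add.hyps have "partial j (\<lambda>x. f x + g x) = (\<lambda>x. partial j f x + partial j g x)" for j
    by (intro ext partial_add d)
  with add show ?case
    by (simp add: partial_add d real_polynomial_function_partial)
next
  case (mult f g)
  note d = differentiable_at_real_polynomial_function
  from mult.hyps have "partial j (\<lambda>x. f x * g x) = (\<lambda>x. f x * partial j g x + partial j f x * g x)" for j
    by (intro ext partial_bilinear bounded_bilinear_mult d)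
  with mult show ?case
    by (simp add: partial_add partial_bilinear[OF bounded_bilinear_mult] d
        real_polynomial_function_partial real_polynomial_function.intros(4))
qed

lemma partial_commute:
  fixes f :: "real^'n::finite \<Rightarrow> 'm::finite clifford"
  assumes "polynomial_function f"
  shows "partial i (partial j f) x = partial j (partial i f) x"
proof (rule clifford_eqI)
  fix A
  have "coeff (partial i (partial j f) x) A = partial i (partial j (\<lambda>y. coeff (f y) A)) x" for i j
    using assms
    by (simp add: coeff_partial differentiable_at_polynomial_function polynomial_function_partial)
  with assms show "coeff (partial i (partial j f) x) A = coeff (partial j (partial i f) x) A"
    by (simp add: polynomial_function_clifford_iff real_partial_commute)
qed

text \<open>The function \<open>t \<mapsto> f (c x + c t e_j)\<close> is differentiated by the chain
  rule and, after pulling out \<open>c ^ Suc k\<close>, directly; then one factor \<open>c\<close>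
  is cancelled.\<close>

lemma partial_homogeneous:
  fixes f :: "real^'n::finite \<Rightarrow> 'm::finite clifford"
  assumes "homogeneous_polynomial (Suc k) f"
  shows "homogeneous_polynomial k (partial j f)"
proof -
  have pf: "polynomial_function f" and hom: "f (c *\<^sub>R x) = c ^ Suc k *\<^sub>R f x" for c x
    using assms by (simp_all add: homogeneous_polynomial_def)
  have d: "f differentiable (at x)" for x
    by (simp add: pf differentiable_at_polynomial_function)
  have pp: "polynomial_function (partial j f)"
    by (simp add: pf polynomial_function_partial)
  have nz: "partial j f (c *\<^sub>R x) = c ^ k *\<^sub>R partial j f x" if "c \<noteq> 0" for c x
  proof -
    let ?h = "\<lambda>t. f (c *\<^sub>R x + t *\<^sub>R axis j 1)"
    have "(?h has_vector_derivative partial j f (c *\<^sub>R x)) (at (c * 0))"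
      using has_vector_derivative_partial[OF d] by simp
    moreover have "((\<lambda>t. c * t) has_vector_derivative c) (at 0)"
      by (auto intro!: derivative_eq_intros simp: has_real_derivative_iff_has_vector_derivative[symmetric])
    ultimately have "((?h \<circ> (\<lambda>t. c * t)) has_vector_derivative c *\<^sub>R partial j f (c *\<^sub>R x)) (at 0)"
      by (rule vector_diff_chain_at[rotated])
    moreover have "?h \<circ> (\<lambda>t. c * t) = (\<lambda>t. c ^ Suc k *\<^sub>R f (x + t *\<^sub>R axis j 1))"
      by (simp add: fun_eq_iff scaleR_add_right flip: hom power_Suc)
    moreover have "((\<lambda>t. c ^ Suc k *\<^sub>R f (x + t *\<^sub>R axis j 1)) has_vector_derivative
        c ^ Suc k *\<^sub>R partial j f x) (at 0)"
      by (intro bounded_linear.has_vector_derivative[OF bounded_linear_scaleR_right]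
          has_vector_derivative_partial d)
    ultimately have "c *\<^sub>R partial j f (c *\<^sub>R x) = c ^ Suc k *\<^sub>R partial j f x"
      by (simp add: vector_derivative_unique_at)
    with that show ?thesis
      by (metis power_Suc scaleR_scaleR real_vector.scale_cancel_left)
  qed
  \<comment> \<open>At \<open>c = 0\<close> nothing can be cancelled; the identity follows as a
    limit, both sides being continuous in \<open>c\<close>.\<close>
  have "partial j f (0 *\<^sub>R x) = 0 ^ k *\<^sub>R partial j f x" for x
  proof (rule LIM_unique)
    have "isCont (partial j f) (0 *\<^sub>R x)"
      using pp by (simp add: differentiable_imp_continuous_within differentiable_at_polynomial_function)
    then show "(\<lambda>c. partial j f (c *\<^sub>R x)) \<midarrow>0\<rightarrow> partial j f (0 *\<^sub>R x)"
      by (intro isCont_tendsto_compose[where g = "partial j f"] tendsto_intros)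
    have "(\<lambda>c. c ^ k *\<^sub>R partial j f x) \<midarrow>0\<rightarrow> 0 ^ k *\<^sub>R partial j f x"
      by (intro tendsto_intros)
    then show "(\<lambda>c. partial j f (c *\<^sub>R x)) \<midarrow>0\<rightarrow> 0 ^ k *\<^sub>R partial j f x"
      by (rule Lim_transform_eventually) (auto simp: eventually_at_filter nz)
  qed
  with nz pp show ?thesis
    unfolding homogeneous_polynomial_def by metis
qed

text \<open>Scaling by \<open>0\<close> suffices, because \<open>0 ^ 0 = 1\<close>.\<close>

lemma homogeneous_0_const:
  assumes "homogeneous_polynomial 0 f"
  shows "f x = f 0"
  using assms unfolding homogeneous_polynomial_def
  by (metis power_0 scaleR_one scaleR_zero_left)

text \<open>Euler's identity: the derivative of \<open>t \<mapsto> f (t x)\<close> at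
  \<open>1\<close> is computed by the chain rule and from homogeneity.\<close>

lemma euler_homogeneous:
  fixes f :: "real^'n::finite \<Rightarrow> 'm::finite clifford"
  assumes "homogeneous_polynomial k f"
  shows "(\<Sum>j\<in>UNIV. (x $ j) *\<^sub>R partial j f x) = real k *\<^sub>R f x"
proof -
  have pf: "polynomial_function f" and hom: "f (c *\<^sub>R x) = c ^ k *\<^sub>R f x" for c x
    using assms by (simp_all add: homogeneous_polynomial_def)
  obtain f' where f': "(f has_derivative f') (at x)"
    using pf differentiable_at_polynomial_function unfolding differentiable_def by blast
  then interpret f': bounded_linear f'
    by (rule has_derivative_bounded_linear)
  have dir: "((\<lambda>t. f (t *\<^sub>R x)) has_vector_derivative f' x) (at 1)"
  proof -
    have "((\<lambda>t. t *\<^sub>R x) has_derivative (\<lambda>t. t *\<^sub>R x)) (at 1)"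
      by (auto intro!: derivative_eq_intros)
    from diff_chain_at[OF this, of f f'] f' show ?thesis
      by (simp add: has_vector_derivative_def o_def f'.scaleR)
  qed
  have "((\<lambda>t. t ^ k *\<^sub>R f x) has_vector_derivative (real k * 1 ^ (k - 1)) *\<^sub>R f x) (at 1)"
    by (auto intro!: derivative_eq_intros simp: has_vector_derivative_def algebra_simps)
  with dir have "f' x = real k *\<^sub>R f x"
    by (simp add: hom vector_derivative_unique_at)
  moreover have "partial j f x = f' (axis j 1)" for j
  proof (rule partial_eqI)
    have "((\<lambda>t. x + t *\<^sub>R axis j (1 :: real)) has_derivative (\<lambda>t. t *\<^sub>R axis j 1)) (at 0)"
      by (auto intro!: derivative_eq_intros)
    from diff_chain_at[OF this, of f f'] f'
    show "((\<lambda>t. f (x + t *\<^sub>R axis j 1)) has_vector_derivative f' (axis j 1)) (at 0)"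
      by (simp add: has_vector_derivative_def o_def f'.scaleR)
  qed
  moreover have "x = (\<Sum>j\<in>UNIV. (x $ j) *\<^sub>R axis j 1)"
    using basis_expansion[of x] by (simp add: scalar_mult_eq_scaleR)
  then have "f' x = (\<Sum>j\<in>UNIV. (x $ j) *\<^sub>R f' (axis j 1))"
    by (metis (no_types, lifting) f'.scaleR f'.sum sum.cong)
  ultimately show ?thesis by simp
qed

section \<open>Dirac operators and the grading\<close>

text \<open>One notion for all grade-dependent scalars: the projections, the constants
  \<open>mu\<close> and \<open>lam\<close>, and the reciprocals needed to invert the Dirac
  operator.\<close>

definition gmult :: "(nat \<Rightarrow> real) \<Rightarrow> 'n clifford \<Rightarrow> 'n clifford"
  where "gmult w a = Abs_clifford (\<lambda>A. w (card A) * coeff a A)"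

lemma coeff_gmult [simp]: "coeff (gmult w a) A = w (card A) * coeff a A"
  by (simp add: gmult_def)

lemma coeff_grade: "coeff (grade l a) (C :: 'n::finite set) = (if card C = l then coeff a C else 0)"
  by (simp add: grade_def coeff_ebasis if_distrib cong: if_cong)

lemma grade_eq_gmult: "grade l (a :: 'n::finite clifford) = gmult (\<lambda>i. if i = l then 1 else 0) a"
  by (rule clifford_eqI) (simp add: coeff_grade)

lemma gmult_eq_sum_grade:
  "gmult w a = (\<Sum>l = 0..CARD('n). w l *\<^sub>R grade l (a :: 'n::finite clifford))"
proof (rule clifford_eqI)
  fix C :: "'n set"
  have "card C \<in> {0..CARD('n)}"
    by (simp add: card_mono)
  then show "coeff (gmult w a) C = coeff (\<Sum>l = 0..CARD('n). w l *\<^sub>R grade l a) C"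
    by (simp add: coeff_grade if_distrib cong: if_cong)
qed

lemma bounded_linear_gmult: "bounded_linear (gmult w :: 'n::finite clifford \<Rightarrow> _)"
  by (subst linear_conv_bounded_linear[symmetric])
    (auto intro!: linearI clifford_eqI simp: algebra_simps)

section \<open>Products with a generator and the origin of the constants \<open>mu\<close>\<close>

lemma coeff_egen_mult:
  "coeff (egen i * a) C = esign {i} (sym_diff {i} C) * coeff a (sym_diff {i} C)"
  for a :: "'n::{finite,linorder} clifford"
proof -
  have "coeff (egen i * a) C =
      (\<Sum>A\<in>UNIV. if A = {i} then esign {i} (sym_diff {i} C) * coeff a (sym_diff {i} C) else 0)"
    unfolding coeff_times by (intro sum.cong refl) (auto simp: coeff_ebasis)
  then show ?thesis by simp
qed

lemma coeff_mult_egen: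
  "coeff (a * egen i) C = esign (sym_diff {i} C) {i} * coeff a (sym_diff {i} C)"
  for a :: "'n::{finite,linorder} clifford"
proof -
  have iff: "sym_diff A C = {i} \<longleftrightarrow> A = sym_diff {i} C" for A
    by blast
  have "coeff (a * egen i) C =
      (\<Sum>A\<in>UNIV. if A = sym_diff {i} C then esign A {i} * coeff a A else 0)"
    unfolding coeff_times
  proof (intro sum.cong refl)
    fix A
    show "esign A (sym_diff A C) * coeff a A * coeff (egen i) (sym_diff A C)
        = (if A = sym_diff {i} C then esign A {i} * coeff a A else 0)"
    proof (cases "sym_diff A C = {i}")
      case True
      then have A: "A = sym_diff {i} C"
        using iff by blast
      show ?thesis
        unfolding True if_P[OF A] by (simp add: coeff_ebasis)
    next
      case False
      then show ?thesis
        using iff[of A] by (simp only: coeff_ebasis if_False mult_zero_right)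
    qed
  qed
  then show ?thesis by simp
qed

text \<open>For \<open>b \<noteq> i\<close> exactly one of \<open>b \<le> i\<close> and
  \<open>i \<le> b\<close> holds, so the product of the two signs picks up one factor
  \<open>- 1\<close>; for \<open>b = i\<close> it picks up two.\<close>

lemma esign_swap:
  "esign B {i} = (- 1) ^ card (B - {i}) * esign {i} (B :: 'n::{finite,linorder} set)"
proof -
  have "esign B {i} * esign {i} B = (\<Prod>b\<in>B. if b = i then 1 else - 1)"
    by (auto simp: esign_def simp flip: prod.distrib intro!: prod.cong)
  also have "\<dots> = (- 1) ^ card (B - {i})"
    by (simp add: prod.If_cases Diff_eq)
  finally show ?thesis
    by (metis esign_square mult.assoc mult.right_neutral)
qed

lemma card_sym_diff_singleton:
  "card (sym_diff {i} C) = (if i \<in> C then card C - 1 else card C + 1)"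
  "card (sym_diff {i} C - {i}) = (if i \<in> C then card C - 1 else card C)"
  for C :: "'n::finite set"
proof -
  have "i \<in> C \<Longrightarrow> sym_diff {i} C = C - {i}" "i \<notin> C \<Longrightarrow> sym_diff {i} C = insert i C"
    by auto
  then show "card (sym_diff {i} C) = (if i \<in> C then card C - 1 else card C + 1)"
    "card (sym_diff {i} C - {i}) = (if i \<in> C then card C - 1 else card C)"
    by auto
qed

lemma sum_split_Compl:
  "sum g UNIV = sum g C + sum g (- C)" for g :: "'n::finite \<Rightarrow> real"
  using sum.subset_diff[of C UNIV g] by (simp add: Compl_eq_Diff_UNIV add.commute)

text \<open>Conjugation by \<open>e_j\<close> maps \<open>e_C\<close> to
  \<open>(- 1) ^ card C\<close> times itself if \<open>j \<in> C\<close>, and to the opposite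
  otherwise. Counting both kinds of \<open>j\<close> gives the factor \<open>2 * card C - m\<close>
  in \<open>mu\<close>.\<close>

lemma sum_egen_conj:
  "(\<Sum>j\<in>UNIV. egen j * a * egen j) = gmult (mu CARD('n)) (a :: 'n::{finite,linorder} clifford)"
proof (rule clifford_eqI)
  fix C :: "'n set"
  have one: "coeff (egen j * a * egen j) C = - ((- 1) ^ card (C - {j}) * coeff a C)" for j
  proof -
    have "esign {j} (sym_diff {j} C) = - esign {j} C"
      unfolding esign_sym_diff_right by (simp add: esign_def)
    moreover have "sym_diff {j} (sym_diff {j} C) = C" by blast
    ultimately have "coeff (egen j * a * egen j) C = - (esign {j} C * esign {j} C) * (- 1) ^ card (C - {j}) * coeff a C"
      by (simp add: mult.assoc coeff_egen_mult coeff_mult_egen esign_swap[of C])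
    then show ?thesis by (simp add: esign_square)
  qed
  have "(\<Sum>j\<in>UNIV. (- 1 :: real) ^ card (C - {j}))
      = (\<Sum>j\<in>C. (- 1) ^ card (C - {j})) + (\<Sum>j\<in>- C. (- 1) ^ card (C - {j}))"
    by (rule sum_split_Compl)
  also have "\<dots> = (\<Sum>j\<in>C. - ((- 1) ^ card C)) + (\<Sum>j\<in>- C. (- 1) ^ card C)"
  proof -
    have "(- 1 :: real) ^ card (C - {j}) = - ((- 1) ^ card C)" if "j \<in> C" for j
      using card.remove[OF _ that] by simp
    then show ?thesis by simp
  qed
  also have "\<dots> = - (mu CARD('n) (card C))"
  proof -
    have *: "real (card (- C)) = real CARD('n) - real (card C)"
      by (simp add: Compl_eq_Diff_UNIV card_Diff_subset card_mono of_nat_diff)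
    show ?thesis
      unfolding mu_def sum_constant * by (simp add: algebra_simps)
  qed
  finally show "coeff (\<Sum>j\<in>UNIV. egen j * a * egen j) C = coeff (gmult (mu CARD('n)) a) C"
    by (simp add: one sum_negf flip: sum_distrib_right)
qed

text \<open>Contribution of \<open>e_j\<close> times the \<open>j\<close>-th partial to the
  coefficient at \<open>C\<close>. It comes from grade \<open>card C - 1\<close> if
  \<open>j \<in> C\<close> and from grade \<open>card C + 1\<close> otherwise.\<close>

definition dirac_part ::
  "(real^'n::{finite,linorder} \<Rightarrow> 'n clifford) \<Rightarrow> real^'n::{finite,linorder} \<Rightarrow>
    'n set \<Rightarrow> 'n \<Rightarrow> real"
  where "dirac_part f x C j = esign {j} (sym_diff {j} C) * coeff (partial j f x) (sym_diff {j} C)"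

text \<open>The sums over \<open>C\<close> and \<open>- C\<close> are the contributions of \<open>\<partial> \<and> f\<close> and \<open>\<partial> \<sqdot> f\<close>: the two Dirac operators
  combine them with different signs, so a two-sided monogenic function is annihilated by each.\<close>

lemma coeff_dirac:
  fixes f :: "real^'n::{finite,linorder} \<Rightarrow> 'n clifford"
  shows "coeff (dirac_left f x) C = sum (dirac_part f x C) C + sum (dirac_part f x C) (- C)"
    and "coeff (dirac_right f x) C
      = (- 1) ^ card C * (sum (dirac_part f x C) (- C) - sum (dirac_part f x C) C)"
proof -
  have split: "sum g UNIV = sum g C + sum g (- C)" for g :: "'n \<Rightarrow> real"
    by (rule sum_split_Compl)
  have "coeff (dirac_left f x) C = sum (dirac_part f x C) UNIV"
    by (simp add: dirac_left_def coeff_egen_mult dirac_part_def)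
  then show "coeff (dirac_left f x) C = sum (dirac_part f x C) C + sum (dirac_part f x C) (- C)"
    by (simp add: split)
  have "coeff (partial j f x * egen j) C
      = (- 1) ^ card C * (if j \<in> C then - dirac_part f x C j else dirac_part f x C j)" for j
  proof -
    have "(- 1 :: real) ^ (card C - 1) = - ((- 1) ^ card C)" if "j \<in> C"
      using that by (cases "card C") auto
    then show ?thesis
      by (simp add: coeff_mult_egen esign_swap[of "sym_diff {j} C"] card_sym_diff_singleton(2)
          dirac_part_def)
  qed
  then show "coeff (dirac_right f x) C
      = (- 1) ^ card C * (sum (dirac_part f x C) (- C) - sum (dirac_part f x C) C)"
    by (simp add: dirac_right_def split sum_negf flip: sum_distrib_left)
qed

lemma dirac_part_eq_0:
  fixes f :: "real^'n::{finite,linorder} \<Rightarrow> 'n clifford"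
  assumes "dirac_left f x = 0" "dirac_right f x = 0"
  shows "sum (dirac_part f x C) C = 0" "sum (dirac_part f x C) (- C) = 0"
  using coeff_dirac[of f x C] assms by auto

lemma dirac_part_gmult:
  fixes f :: "real^'n::{finite,linorder} \<Rightarrow> 'n clifford"
  assumes "f differentiable (at x)"
  shows "dirac_part (\<lambda>y. gmult w (f y)) x C j
    = w (if j \<in> C then card C - 1 else card C + 1) * dirac_part f x C j"
  by (simp add: dirac_part_def partial_bounded_linear[OF bounded_linear_gmult assms]
      card_sym_diff_singleton(1))

text \<open>The sum over \<open>C\<close> sees a single grade of \<open>f\<close>, and so does the
  sum over \<open>- C\<close>; a gradewise factor therefore only rescales two sums that already
  vanish. In particular every projection of a two-sided monogenic function is two-sided
  monogenic.\<close>

lemma dirac_gmult_eq_0: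
  fixes f :: "real^'n::{finite,linorder} \<Rightarrow> 'n clifford"
  assumes "dirac_left f x = 0" "dirac_right f x = 0" "f differentiable (at x)"
  shows "dirac_left (\<lambda>y. gmult w (f y)) x = 0" "dirac_right (\<lambda>y. gmult w (f y)) x = 0"
proof -
  have "sum (dirac_part (\<lambda>y. gmult w (f y)) x C) C = w (card C - 1) * sum (dirac_part f x C) C"
    "sum (dirac_part (\<lambda>y. gmult w (f y)) x C) (- C) = w (card C + 1) * sum (dirac_part f x C) (- C)" for C
    by (simp_all add: dirac_part_gmult[OF assms(3)] sum_distrib_left)
  then show "dirac_left (\<lambda>y. gmult w (f y)) x = 0" "dirac_right (\<lambda>y. gmult w (f y)) x = 0"
    using dirac_part_eq_0[OF assms(1,2)] by (simp_all add: clifford_eq_iff coeff_dirac)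
qed

text \<open>For \<open>C = UNIV\<close> the sum over \<open>- C\<close> is empty, and in even
  dimension the two operators give the remaining sum opposite signs. This later removes the
  pseudoscalar obstruction.\<close>

lemma coeff_UNIV_dirac_left:
  fixes f :: "real^'n::{finite,linorder} \<Rightarrow> 'n clifford"
  assumes "dirac_left f x = dirac_right f x" "even CARD('n)"
  shows "coeff (dirac_left f x) UNIV = 0"
  using coeff_dirac[of f x UNIV] assms by simp

section \<open>Dirac derivatives of products with the vector variable\<close>

lemma bounded_linear_cvec: "bounded_linear (cvec :: real^'n::finite \<Rightarrow> _)"
  by (subst linear_conv_bounded_linear[symmetric])
    (auto intro!: linearI simp: cvec_def algebra_simps sum.distrib scaleR_sum_right)

lemma partial_cvec: "partial j cvec x = (egen j :: 'n::finite clifford)"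
  by (simp add: partial_of_bounded_linear[OF bounded_linear_cvec] cvec_def axis_def if_distrib if_distribR
      cong: if_cong)

lemma polynomial_function_cvec: "polynomial_function (cvec :: real^'n::finite \<Rightarrow> _)"
  by (rule polynomial_function_bounded_linear[OF bounded_linear_cvec])

lemma egen_cvec:
  "egen j * cvec x = - (2 * x $ j) *\<^sub>R (1 :: 'n::{finite,linorder} clifford) - cvec x * egen j"
proof -
  have "egen j * cvec x + cvec x * egen j = (\<Sum>i\<in>UNIV. (x $ i) *\<^sub>R (egen j * egen i + egen i * egen j))"
    by (simp add: cvec_def sum_distrib_left sum_distrib_right scaleR_add_right sum.distrib)
  also have "\<dots> = (\<Sum>i\<in>UNIV. if i = j then - (2 * x $ j) *\<^sub>R 1 else 0)"
  proof (intro sum.cong refl)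
    fix i
    have two: "(2 :: 'n clifford) = 2 *\<^sub>R 1"
      by (simp add: scaleR_conv_of_real)
    show "(x $ i) *\<^sub>R (egen j * egen i + egen i * egen j)
        = (if i = j then - (2 * x $ j) *\<^sub>R (1 :: 'n clifford) else 0)"
      unfolding egen_anticommute two by (auto simp: mult.commute)
  qed
  finally show ?thesis
    by (simp add: algebra_simps)
qed

lemma egen_square: "egen j * egen j = (- 1 :: 'n::{finite,linorder} clifford)"
  by (simp add: ebasis_mult esign_def one_clifford_def)

context
  fixes f :: "real^'n::{finite,linorder} \<Rightarrow> 'n clifford" and x :: "real^'n::{finite,linorder}"
  assumes diff: "f differentiable (at x)"
begin

lemma partial_cvec_mult: "partial j (\<lambda>y. cvec y * f y) x = cvec x * partial j f x + egen j * f x"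
  by (subst partial_bilinear[OF bounded_bilinear_clifford_times _ diff])
    (auto simp: partial_cvec differentiable_at_polynomial_function polynomial_function_cvec)

lemma partial_mult_cvec: "partial j (\<lambda>y. f y * cvec y) x = f x * egen j + partial j f x * cvec x"
  by (subst partial_bilinear[OF bounded_bilinear_clifford_times diff])
    (auto simp: partial_cvec differentiable_at_polynomial_function polynomial_function_cvec)

text \<open>Moving \<open>egen j\<close> past \<open>cvec x\<close> leaves the scalar
  \<open>- 2 x_j\<close>, hence the Euler operator; the squares \<open>e_j e_j = - 1\<close> add up
  to minus the dimension.\<close>

lemma dirac_left_cvec_mult:
  "dirac_left (\<lambda>y. cvec y * f y) x = - (real CARD('n) *\<^sub>R f x)
    - 2 *\<^sub>R (\<Sum>j\<in>UNIV. (x $ j) *\<^sub>R partial j f x) - cvec x * dirac_left f x"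
proof -
  have "egen j * (cvec x * partial j f x + egen j * f x)
      = - (2 *\<^sub>R ((x $ j) *\<^sub>R partial j f x)) - cvec x * (egen j * partial j f x) - f x" for j
    by (simp add: distrib_left egen_cvec left_diff_distrib egen_square flip: mult.assoc)
  then show ?thesis
    by (simp add: dirac_left_def partial_cvec_mult sum_subtractf sum_negf sum_distrib_left
        scaleR_sum_right sum_constant_scaleR del: sum_constant)
qed

lemma dirac_right_mult_cvec:
  "dirac_right (\<lambda>y. f y * cvec y) x = - (real CARD('n) *\<^sub>R f x)
    - 2 *\<^sub>R (\<Sum>j\<in>UNIV. (x $ j) *\<^sub>R partial j f x) - dirac_right f x * cvec x"
proof -
  have ce: "cvec x * egen j = - (2 * x $ j) *\<^sub>R 1 - egen j * cvec x" for j
    using egen_cvec[of j x] by (simp add: algebra_simps)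
  have "(f x * egen j + partial j f x * cvec x) * egen j
      = - (2 *\<^sub>R ((x $ j) *\<^sub>R partial j f x)) - partial j f x * egen j * cvec x - f x" for j
    by (simp add: distrib_right ce right_diff_distrib egen_square mult.assoc)
  then show ?thesis
    by (simp add: dirac_right_def partial_mult_cvec sum_subtractf sum_negf sum_distrib_right
        scaleR_sum_right sum_constant_scaleR del: sum_constant)
qed

text \<open>With the vector on the far side, its derivative sandwiches \<open>f\<close> between two
  copies of \<open>egen j\<close>, which is how \<open>mu\<close> enters.\<close>

lemma dirac_left_mult_cvec:
  "dirac_left (\<lambda>y. f y * cvec y) x = gmult (mu CARD('n)) (f x) + dirac_left f x * cvec x"
  by (simp add: dirac_left_def partial_mult_cvec distrib_left sum.distrib sum_distrib_right
      flip: sum_egen_conj mult.assoc)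

lemma dirac_right_cvec_mult:
  "dirac_right (\<lambda>y. cvec y * f y) x = gmult (mu CARD('n)) (f x) + cvec x * dirac_right f x"
  by (simp add: dirac_right_def partial_cvec_mult distrib_right sum.distrib sum_distrib_left
      mult.assoc flip: sum_egen_conj)

text \<open>For \<open>p = 0\<close> the truncated exponent \<open>p - 1\<close> is harmless, since
  the factor \<open>real p\<close> vanishes.\<close>

lemma partial_inner_power_scaleR:
  "partial j (\<lambda>y. (y \<bullet> y) ^ p *\<^sub>R f y) x
    = (x \<bullet> x) ^ p *\<^sub>R partial j f x + (2 * real p * (x \<bullet> x) ^ (p - 1) * x $ j) *\<^sub>R f x"
proof -
  have "((\<lambda>t. ((x + t *\<^sub>R axis j 1) \<bullet> (x + t *\<^sub>R axis j 1)) ^ p) has_vector_derivative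
      2 * real p * (x \<bullet> x) ^ (p - 1) * x $ j) (at 0)"
    unfolding has_real_derivative_iff_has_vector_derivative[symmetric]
    by (auto intro!: derivative_eq_intros simp: inner_axis inner_axis' algebra_simps has_field_derivative_def)
  from partial_eqI[OF this] have "partial j (\<lambda>y. (y \<bullet> y) ^ p) x = 2 * real p * (x \<bullet> x) ^ (p - 1) * x $ j" .
  then show ?thesis
    by (subst partial_bilinear[OF bounded_bilinear_scaleR _ diff])
      (auto intro!: derivative_intros)
qed

lemma dirac_left_inner_power_scaleR:
  "dirac_left (\<lambda>y. (y \<bullet> y) ^ p *\<^sub>R f y) x
    = (2 * real p * (x \<bullet> x) ^ (p - 1)) *\<^sub>R (cvec x * f x) + (x \<bullet> x) ^ p *\<^sub>R dirac_left f x"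
  by (simp add: dirac_left_def partial_inner_power_scaleR distrib_left sum.distrib cvec_def
      scaleR_sum_right sum_distrib_right add.commute)

lemma dirac_right_inner_power_scaleR:
  "dirac_right (\<lambda>y. (y \<bullet> y) ^ p *\<^sub>R f y) x
    = (2 * real p * (x \<bullet> x) ^ (p - 1)) *\<^sub>R (f x * cvec x) + (x \<bullet> x) ^ p *\<^sub>R dirac_right f x"
  by (simp add: dirac_right_def partial_inner_power_scaleR distrib_right sum.distrib cvec_def
      scaleR_sum_right sum_distrib_left add.commute)

end

section \<open>Two-sided monogenic polynomials\<close>

lemma polynomial_function_dirac:
  fixes f :: "real^'n::{finite,linorder} \<Rightarrow> 'n clifford"
  assumes "polynomial_function f"
  shows "polynomial_function (dirac_left f)" "polynomial_function (dirac_right f)"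
  unfolding dirac_left_def[abs_def] dirac_right_def[abs_def]
  by (auto intro!: polynomial_function_sum polynomial_function_clifford_times
      polynomial_function_partial assms)

text \<open>Associativity separates left from right multiplication, and the partial derivatives
  commute.\<close>

lemma dirac_left_right_commute:
  fixes f :: "real^'n::{finite,linorder} \<Rightarrow> 'n clifford"
  assumes "polynomial_function f"
  shows "dirac_left (dirac_right f) x = dirac_right (dirac_left f) x"
proof -
  note d = differentiable_at_polynomial_function polynomial_function_clifford_times
    polynomial_function_partial[OF assms]
  have "partial i (dirac_right f) x = (\<Sum>j\<in>UNIV. partial i (partial j f) x * egen j)" for i
    unfolding dirac_right_def[abs_def]
    by (simp add: partial_sum partial_bounded_linear[OF bounded_linear_clifford_mult_left] d)
  moreover have "partial i (dirac_left f) x = (\<Sum>j\<in>UNIV. egen j * partial i (partial j f) x)" for i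
    unfolding dirac_left_def[abs_def]
    by (simp add: partial_sum partial_bounded_linear[OF bounded_linear_clifford_mult_right] d)
  ultimately show ?thesis
    unfolding dirac_left_def[of "dirac_right f"] dirac_right_def[of "dirac_left f"]
    by (simp add: sum_distrib_left sum_distrib_right mult.assoc)
      (subst sum.swap, simp add: partial_commute[OF assms])
qed

lemma dirac_sum:
  fixes f :: "'i \<Rightarrow> real^'n::{finite,linorder} \<Rightarrow> 'n clifford"
  assumes "\<And>i. i \<in> I \<Longrightarrow> f i differentiable (at x)"
  shows "dirac_left (\<lambda>y. \<Sum>i\<in>I. f i y) x = (\<Sum>i\<in>I. dirac_left (f i) x)"
    and "dirac_right (\<lambda>y. \<Sum>i\<in>I. f i y) x = (\<Sum>i\<in>I. dirac_right (f i) x)"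
  using sum.swap[of "\<lambda>i j. egen j * partial j (f i) x" UNIV I]
    sum.swap[of "\<lambda>i j. partial j (f i) x * egen j" UNIV I]
  by (simp_all add: dirac_left_def dirac_right_def partial_sum assms sum_distrib_left sum_distrib_right)

lemma dirac_add:
  fixes f g :: "real^'n::{finite,linorder} \<Rightarrow> 'n clifford"
  assumes "f differentiable (at x)" "g differentiable (at x)"
  shows "dirac_left (\<lambda>y. f y + g y) x = dirac_left f x + dirac_left g x"
    and "dirac_right (\<lambda>y. f y + g y) x = dirac_right f x + dirac_right g x"
  by (simp_all add: dirac_left_def dirac_right_def partial_add assms algebra_simps sum.distrib)

lemma dirac_scaleR:
  fixes f :: "real^'n::{finite,linorder} \<Rightarrow> 'n clifford"
  assumes "f differentiable (at x)"
  shows "dirac_left (\<lambda>y. c *\<^sub>R f y) x = c *\<^sub>R dirac_left f x"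
    and "dirac_right (\<lambda>y. c *\<^sub>R f y) x = c *\<^sub>R dirac_right f x"
  by (simp_all add: dirac_left_def dirac_right_def scaleR_sum_right
      partial_bounded_linear[OF bounded_linear_scaleR_right assms])

lemma dirac_const [simp]: "dirac_left (\<lambda>x. c) = (\<lambda>x. 0)" "dirac_right (\<lambda>x. c) = (\<lambda>x. 0)"
  by (simp_all add: fun_eq_iff dirac_left_def dirac_right_def)

section \<open>Closure properties of homogeneous polynomials\<close>

lemma homogeneous_linear_image:
  fixes f :: "'a::euclidean_space \<Rightarrow> 'b::real_normed_vector"
  assumes "homogeneous_polynomial k f" "bounded_linear L"
  shows "homogeneous_polynomial k (\<lambda>x. L (f x))"
  using assms polynomial_function_linear_image[of f L]
  by (simp add: homogeneous_polynomial_def linear_cmul bounded_linear.linear)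

lemma homogeneous_add:
  assumes "homogeneous_polynomial k f" "homogeneous_polynomial k g"
  shows "homogeneous_polynomial k (\<lambda>x. f x + g x)"
  using assms by (auto simp: homogeneous_polynomial_def scaleR_add_right)

lemma homogeneous_sum:
  assumes "finite I" "\<And>i. i \<in> I \<Longrightarrow> homogeneous_polynomial k (f i)"
  shows "homogeneous_polynomial k (\<lambda>x. \<Sum>i\<in>I. f i x)"
  using assms by (auto simp: homogeneous_polynomial_def scaleR_sum_right)

lemma homogeneous_clifford_times:
  fixes f g :: "'a::euclidean_space \<Rightarrow> 'n::{finite,linorder} clifford"
  assumes "homogeneous_polynomial k f" "homogeneous_polynomial l g"
  shows "homogeneous_polynomial (k + l) (\<lambda>x. f x * g x)"
  using assms by (auto simp: homogeneous_polynomial_def polynomial_function_clifford_times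
      power_add mult.commute)

lemma homogeneous_inner_power_scaleR:
  fixes f :: "'a::euclidean_space \<Rightarrow> 'n::finite clifford"
  assumes "homogeneous_polynomial k f"
  shows "homogeneous_polynomial (2 * p + k) (\<lambda>x. (x \<bullet> x) ^ p *\<^sub>R f x)"
proof -
  have "real_polynomial_function (\<lambda>x :: 'a. (x \<bullet> x) ^ p)"
    unfolding euclidean_inner[of x x for x :: 'a]
    by (intro real_polynomial_function_power real_polynomial_function_sum
        real_polynomial_function.intros(4) real_polynomial_function.intros(1)
        bounded_linear_inner_left finite_Basis)
  with assms show ?thesis
    by (auto simp: homogeneous_polynomial_def polynomial_function_scaleR power_add power_mult
        power_mult_distrib power2_eq_square algebra_simps)
qed

lemma homogeneous_cvec: "homogeneous_polynomial 1 (cvec :: real^'n::finite \<Rightarrow> _)"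
  by (simp add: homogeneous_polynomial_def polynomial_function_cvec
      linear_cmul[OF bounded_linear.linear[OF bounded_linear_cvec]])

lemma homogeneous_dirac:
  fixes f :: "real^'n::{finite,linorder} \<Rightarrow> 'n clifford"
  assumes "homogeneous_polynomial (Suc k) f"
  shows "homogeneous_polynomial k (dirac_left f)" "homogeneous_polynomial k (dirac_right f)"
  unfolding dirac_left_def[abs_def] dirac_right_def[abs_def]
  by (auto intro!: homogeneous_sum partial_homogeneous assms
      homogeneous_linear_image[OF _ bounded_linear_clifford_mult_left]
      homogeneous_linear_image[OF _ bounded_linear_clifford_mult_right])

lemma homogeneous_0_dirac:
  assumes "homogeneous_polynomial 0 f"
  shows "dirac_left f = (\<lambda>x. 0)" "dirac_right f = (\<lambda>x. 0)"
proof -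
  have "f = (\<lambda>x. f 0)"
    using homogeneous_0_const[OF assms] by blast
  then show "dirac_left f = (\<lambda>x. 0)" "dirac_right f = (\<lambda>x. 0)"
    using dirac_const by metis+
qed

lemma homogeneous_differentiable:
  fixes f :: "'a::euclidean_space \<Rightarrow> 'n::finite clifford"
  shows "homogeneous_polynomial k f \<Longrightarrow> f differentiable (at x)"
  by (simp add: homogeneous_polynomial_def differentiable_at_polynomial_function)

abbreviation two_sided_polys :: "nat \<Rightarrow> (real^'n::{finite,linorder} \<Rightarrow> 'n clifford) set"
  where "two_sided_polys n \<equiv> left_monogenic_polys n \<inter> right_monogenic_polys n"

lemma two_sided_polysD:
  assumes "S \<in> two_sided_polys j"
  shows "homogeneous_polynomial j S" "dirac_left S x = 0" "dirac_right S x = 0"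
  using assms by (auto simp: left_monogenic_polys_def right_monogenic_polys_def)

lemma two_sided_polys_gmult:
  assumes "S \<in> two_sided_polys j"
  shows "(\<lambda>y. gmult w (S y)) \<in> two_sided_polys j"
  using two_sided_polysD[OF assms] dirac_gmult_eq_0[of S _ w]
  by (simp add: left_monogenic_polys_def right_monogenic_polys_def homogeneous_differentiable
      homogeneous_linear_image[OF _ bounded_linear_gmult])

text \<open>The term with \<open>n = 2 * p + 1\<close>. A power of \<open>y \<bullet> y\<close> is
  used instead of one of the norm because it is visibly polynomial.\<close>

definition odd_term ::
  "nat \<Rightarrow> (real^'n::{finite,linorder} \<Rightarrow> 'n clifford) \<Rightarrow> real^'n::{finite,linorder} \<Rightarrow> 'n clifford"
  where "odd_term p S y = (y \<bullet> y) ^ p *\<^sub>R (cvec y * S y + S y * cvec y)"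

text \<open>Here \<open>S\<close> has degree \<open>j\<close>, so the total degree, called \<open>k\<close> in \<open>lam\<close>, is \<open>j + 2 * p\<close>; only
  \<open>p > 0\<close> is meaningful, since \<open>lam\<close> divides by \<open>2 * p\<close>.\<close>

definition even_term ::
  "nat \<Rightarrow> nat \<Rightarrow> (real^'n::{finite,linorder} \<Rightarrow> 'n clifford) \<Rightarrow> real^'n::{finite,linorder} \<Rightarrow> 'n clifford"
  where "even_term j p S y = (y \<bullet> y) ^ p *\<^sub>R gmult (lam CARD('n) (j + 2 * p) (2 * p)) (S y)
    + (y \<bullet> y) ^ (p - 1) *\<^sub>R (cvec y * S y * cvec y)"

lemma homogeneous_terms:
  fixes S :: "real^'n::{finite,linorder} \<Rightarrow> 'n clifford"
  assumes "homogeneous_polynomial j S"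
  shows "homogeneous_polynomial (j + Suc (2 * p)) (odd_term p S)"
    and "p > 0 \<Longrightarrow> homogeneous_polynomial (j + 2 * p) (even_term j p S)"
proof -
  note ct = homogeneous_clifford_times
  have "homogeneous_polynomial (Suc j) (\<lambda>y. cvec y * S y + S y * cvec y)"
    using ct[OF homogeneous_cvec assms] ct[OF assms homogeneous_cvec] by (auto intro: homogeneous_add)
  from homogeneous_inner_power_scaleR[OF this, of p]
  show "homogeneous_polynomial (j + Suc (2 * p)) (odd_term p S)"
    by (simp add: odd_term_def[abs_def] add.commute)
  \<comment> \<open>For \<open>p = 0\<close> the exponent \<open>p - 1\<close> is truncated, and the
    sandwich summand would have degree \<open>j + 2\<close> instead of \<open>j\<close>.\<close>
  assume "p > 0"
  then obtain q where p: "p = Suc q"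
    using gr0_implies_Suc by blast
  show "homogeneous_polynomial (j + 2 * p) (even_term j p S)"
    using homogeneous_inner_power_scaleR[OF ct[OF ct[OF homogeneous_cvec assms] homogeneous_cvec], of q]
      homogeneous_inner_power_scaleR[OF homogeneous_linear_image[OF assms bounded_linear_gmult], of p]
    unfolding even_term_def[abs_def] by (intro homogeneous_add) (simp_all add: p add.commute)
qed

context
  fixes S :: "real^'n::{finite,linorder} \<Rightarrow> 'n clifford" and j :: nat
  assumes S: "S \<in> two_sided_polys j"
begin

private lemmas hS = two_sided_polysD(1)[OF S]
private lemmas diff = homogeneous_differentiable[OF hS]
private lemmas ct = homogeneous_clifford_times

lemma dirac_cvec_two_sided:
  "dirac_left (\<lambda>y. cvec y * S y) x = - (real CARD('n) + 2 * j) *\<^sub>R S x"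
  "dirac_right (\<lambda>y. S y * cvec y) x = - (real CARD('n) + 2 * j) *\<^sub>R S x"
  "dirac_left (\<lambda>y. S y * cvec y) x = gmult (mu CARD('n)) (S x)"
  "dirac_right (\<lambda>y. cvec y * S y) x = gmult (mu CARD('n)) (S x)"
  using two_sided_polysD[OF S]
  by (simp_all add: diff dirac_left_cvec_mult dirac_right_mult_cvec dirac_left_mult_cvec
      dirac_right_cvec_mult euler_homogeneous[OF hS] algebra_simps)

text \<open>The outer factor on the side of the operator is peeled off first. What remains is a
  product of degree \<open>j + 1\<close>, so Euler's identity yields \<open>2 * j + 2\<close>, and
  its own derivative is the \<open>mu\<close> term.\<close>

lemma dirac_cvec_cvec_two_sided:
  "dirac_left (\<lambda>y. cvec y * S y * cvec y) x
    = - (real CARD('n) + 2 * j + 2) *\<^sub>R (S x * cvec x) - cvec x * gmult (mu CARD('n)) (S x)"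
  "dirac_right (\<lambda>y. cvec y * S y * cvec y) x
    = - (real CARD('n) + 2 * j + 2) *\<^sub>R (cvec x * S x) - gmult (mu CARD('n)) (S x) * cvec x"
proof -
  have h: "homogeneous_polynomial (Suc j) (\<lambda>y. cvec y * S y)" "homogeneous_polynomial (Suc j) (\<lambda>y. S y * cvec y)"
    using ct[OF homogeneous_cvec hS] ct[OF hS homogeneous_cvec] by simp_all
  show "dirac_left (\<lambda>y. cvec y * S y * cvec y) x
    = - (real CARD('n) + 2 * j + 2) *\<^sub>R (S x * cvec x) - cvec x * gmult (mu CARD('n)) (S x)"
    unfolding mult.assoc
    unfolding dirac_left_cvec_mult[OF homogeneous_differentiable[OF h(2)]]
      euler_homogeneous[OF h(2)] dirac_cvec_two_sided
    by (simp add: algebra_simps)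
  show "dirac_right (\<lambda>y. cvec y * S y * cvec y) x
    = - (real CARD('n) + 2 * j + 2) *\<^sub>R (cvec x * S x) - gmult (mu CARD('n)) (S x) * cvec x"
    unfolding dirac_right_mult_cvec[OF homogeneous_differentiable[OF h(1)]]
      euler_homogeneous[OF h(1)] dirac_cvec_two_sided
    by (simp add: algebra_simps)
qed

private lemma cvec_cvec:
  "cvec x * (cvec x * a) = - ((x \<bullet> x) *\<^sub>R a)" "a * cvec x * cvec x = - ((x \<bullet> x) *\<^sub>R (a :: 'n clifford))"
  using cvec_square[of x] by (simp_all add: mult.assoc power2_norm_eq_inner flip: mult.assoc[of "cvec x" "cvec x"])

text \<open>One of the two products contributes \<open>mu\<close>, the other
  \<open>- (m + 2 * j)\<close>. Changing sides exchanges their roles and keeps the sum.\<close>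

lemma dirac_odd_term_0:
  "dirac_left (odd_term 0 S) x = gmult (\<lambda>l. mu CARD('n) l - real CARD('n) - 2 * j) (S x)"
  "dirac_right (odd_term 0 S) x = gmult (\<lambda>l. mu CARD('n) l - real CARD('n) - 2 * j) (S x)"
proof -
  have "gmult (\<lambda>l. mu CARD('n) l - real CARD('n) - 2 * j) (S x) = gmult (mu CARD('n)) (S x) - (real CARD('n) + 2 * j) *\<^sub>R S x"
    by (rule clifford_eqI) (simp add: algebra_simps)
  then show "dirac_left (odd_term 0 S) x = gmult (\<lambda>l. mu CARD('n) l - real CARD('n) - 2 * j) (S x)"
    "dirac_right (odd_term 0 S) x = gmult (\<lambda>l. mu CARD('n) l - real CARD('n) - 2 * j) (S x)"
    using homogeneous_differentiable[OF ct[OF homogeneous_cvec hS]]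
      homogeneous_differentiable[OF ct[OF hS homogeneous_cvec]]
    by (simp_all add: odd_term_def[abs_def] dirac_add dirac_cvec_two_sided algebra_simps)
qed

lemma dirac_odd_term:
  "dirac_left (odd_term (Suc p) S) x = (2 * real (Suc p)) *\<^sub>R even_term j (Suc p) S x"
  "dirac_right (odd_term (Suc p) S) x = (2 * real (Suc p)) *\<^sub>R even_term j (Suc p) S x"
proof -
  let ?q = "2 * real (Suc p)"
  have h: "homogeneous_polynomial (Suc j) (\<lambda>y. cvec y * S y + S y * cvec y)"
    using ct[OF homogeneous_cvec hS] ct[OF hS homogeneous_cvec] by (auto intro: homogeneous_add)
  \<comment> \<open>With total degree \<open>j + n\<close> and \<open>n = 2 * Suc p\<close>,
    \<open>lam\<close> satisfies \<open>n * lam = mu - m - 2 * j - n\<close>. The extra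
    \<open>- n\<close> absorbs the \<open>- (x \<bullet> x)\<close> coming from the square of
    \<open>cvec x\<close>.\<close>
  have lam: "gmult (mu CARD('n)) (S x) - (real CARD('n) + 2 * j) *\<^sub>R S x - ?q *\<^sub>R S x
      = ?q *\<^sub>R gmult (lam CARD('n) (j + 2 * Suc p) (2 * Suc p)) (S x)"
  proof (rule clifford_eqI)
    fix A :: "'n set"
    have "?q * lam CARD('n) (j + 2 * Suc p) (2 * Suc p) l = mu CARD('n) l - (real CARD('n) + 2 * j) - ?q" for l
      by (simp add: lam_def field_simps)
    then show "coeff (gmult (mu CARD('n)) (S x) - (real CARD('n) + 2 * j) *\<^sub>R S x - ?q *\<^sub>R S x) A
        = coeff (?q *\<^sub>R gmult (lam CARD('n) (j + 2 * Suc p) (2 * Suc p)) (S x)) A"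
      by (simp only: coeff_diff coeff_scaleR coeff_gmult mult.assoc[symmetric] left_diff_distrib)
  qed
  have D: "dirac_left (\<lambda>y. cvec y * S y + S y * cvec y) x = gmult (mu CARD('n)) (S x) - (real CARD('n) + 2 * j) *\<^sub>R S x"
    "dirac_right (\<lambda>y. cvec y * S y + S y * cvec y) x = gmult (mu CARD('n)) (S x) - (real CARD('n) + 2 * j) *\<^sub>R S x"
    using homogeneous_differentiable[OF ct[OF homogeneous_cvec hS]]
      homogeneous_differentiable[OF ct[OF hS homogeneous_cvec]]
    by (simp_all add: dirac_add dirac_cvec_two_sided algebra_simps)
  have ev: "?q *\<^sub>R even_term j (Suc p) S x
      = (?q * (x \<bullet> x) ^ p) *\<^sub>R (cvec x * S x * cvec x - (x \<bullet> x) *\<^sub>R S x)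
        + (x \<bullet> x) ^ Suc p *\<^sub>R (gmult (mu CARD('n)) (S x) - (real CARD('n) + 2 * j) *\<^sub>R S x)"
  proof -
    have "?q *\<^sub>R even_term j (Suc p) S x
      = (x \<bullet> x) ^ Suc p *\<^sub>R (?q *\<^sub>R gmult (lam CARD('n) (j + 2 * Suc p) (2 * Suc p)) (S x))
        + (?q * (x \<bullet> x) ^ p) *\<^sub>R (cvec x * S x * cvec x)"
      unfolding even_term_def by (simp only: scaleR_add_right scaleR_scaleR mult.commute diff_Suc_1)
    then show ?thesis
      unfolding lam[symmetric] by (simp add: algebra_simps)
  qed
  note dl = dirac_left_inner_power_scaleR[OF homogeneous_differentiable[OF h], of "Suc p" x]
  note dr = dirac_right_inner_power_scaleR[OF homogeneous_differentiable[OF h], of "Suc p" x]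
  \<comment> \<open>Multiplying \<open>x S + S x\<close> by \<open>x\<close> from the left or from
    the right gives the same element; hence both derivatives agree.\<close>
  have "cvec x * (cvec x * S x + S x * cvec x) = cvec x * S x * cvec x - (x \<bullet> x) *\<^sub>R S x"
    "(cvec x * S x + S x * cvec x) * cvec x = cvec x * S x * cvec x - (x \<bullet> x) *\<^sub>R S x"
    by (simp_all add: distrib_left distrib_right cvec_cvec mult.assoc)
      (simp_all add: cvec_cvec flip: mult.assoc)
  then show "dirac_left (odd_term (Suc p) S) x = ?q *\<^sub>R even_term j (Suc p) S x"
    "dirac_right (odd_term (Suc p) S) x = ?q *\<^sub>R even_term j (Suc p) S x"
    using dl dr unfolding ev odd_term_def[abs_def] D by (simp_all only: diff_Suc_1)
qed

text \<open>The \<open>mu\<close> part of \<open>lam\<close> cancels the \<open>mu\<close> term from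
  the sandwich. What is left of \<open>x S\<close> and \<open>S x\<close> then carries the same
  coefficient \<open>- (m + 2 * j + 2 * p + 2)\<close>, so \<open>odd_term\<close>
  reappears.\<close>

lemma dirac_even_term:
  "dirac_left (even_term j (Suc p) S) x = - (2 * real j + 2 * real p + 2 + real CARD('n)) *\<^sub>R odd_term p S x"
  "dirac_right (even_term j (Suc p) S) x = - (2 * real j + 2 * real p + 2 + real CARD('n)) *\<^sub>R odd_term p S x"
proof -
  let ?q = "2 * real (Suc p)"
  let ?l = "lam CARD('n) (j + 2 * Suc p) (2 * Suc p)"
  have lam: "?q *\<^sub>R gmult ?l (S x) = gmult (mu CARD('n)) (S x) - (real CARD('n) + 2 * j + ?q) *\<^sub>R S x"
  proof (rule clifford_eqI)
    fix A :: "'n set"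
    have "?q * lam CARD('n) (j + 2 * Suc p) (2 * Suc p) l = mu CARD('n) l - (real CARD('n) + 2 * j + ?q)" for l
      by (simp add: lam_def field_simps)
    then show "coeff (?q *\<^sub>R gmult ?l (S x)) A = coeff (gmult (mu CARD('n)) (S x) - (real CARD('n) + 2 * j + ?q) *\<^sub>R S x) A"
      by (simp only: coeff_diff coeff_scaleR coeff_gmult mult.assoc[symmetric] left_diff_distrib)
  qed
  note G = two_sided_polys_gmult[OF S, of ?l]
  have hG: "homogeneous_polynomial j (\<lambda>y. gmult ?l (S y))"
    and hX: "homogeneous_polynomial (1 + j + 1) (\<lambda>y. cvec y * S y * cvec y)"
    using two_sided_polysD(1)[OF G] ct[OF ct[OF homogeneous_cvec hS] homogeneous_cvec] by simp_all
  note dG = homogeneous_differentiable[OF hG] and dX = homogeneous_differentiable[OF hX]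
  note dG' = homogeneous_differentiable[OF homogeneous_inner_power_scaleR[OF hG, of "Suc p"]]
  note dX' = homogeneous_differentiable[OF homogeneous_inner_power_scaleR[OF hX, of p]]
  \<comment> \<open>For \<open>p = 0\<close> both sides vanish; otherwise the square of
    \<open>cvec x\<close> restores the missing power of \<open>x \<bullet> x\<close>.\<close>
  have xx: "(2 * real p * (x \<bullet> x) ^ (p - 1)) *\<^sub>R (cvec x * (cvec x * S x * cvec x))
      = - ((2 * real p * (x \<bullet> x) ^ p) *\<^sub>R (S x * cvec x))"
    "(2 * real p * (x \<bullet> x) ^ (p - 1)) *\<^sub>R (cvec x * S x * cvec x * cvec x)
      = - ((2 * real p * (x \<bullet> x) ^ p) *\<^sub>R (cvec x * S x))"
    by (cases p; simp add: cvec_cvec mult.assoc mult_ac(2); simp add: cvec_cvec mult_ac flip: mult.assoc)+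
  have "dirac_left (even_term j (Suc p) S) x
      = (x \<bullet> x) ^ p *\<^sub>R (cvec x * (?q *\<^sub>R gmult ?l (S x)))
        - (2 * real p * (x \<bullet> x) ^ p) *\<^sub>R (S x * cvec x)
        + (x \<bullet> x) ^ p *\<^sub>R (- (real CARD('n) + 2 * j + 2) *\<^sub>R (S x * cvec x) - cvec x * gmult (mu CARD('n)) (S x))"
    unfolding even_term_def[abs_def] diff_Suc_1 dirac_add(1)[OF dG' dX']
      dirac_left_inner_power_scaleR[OF dG] dirac_left_inner_power_scaleR[OF dX]
      dirac_cvec_cvec_two_sided two_sided_polysD(2)[OF G] xx
    by (simp add: mult.commute)
  also have "\<dots> = - (2 * real j + 2 * real p + 2 + real CARD('n)) *\<^sub>R odd_term p S x"
    unfolding lam odd_term_def by (simp add: algebra_simps)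
  finally show "dirac_left (even_term j (Suc p) S) x = - (2 * real j + 2 * real p + 2 + real CARD('n)) *\<^sub>R odd_term p S x" .
  have "dirac_right (even_term j (Suc p) S) x
      = (x \<bullet> x) ^ p *\<^sub>R ((?q *\<^sub>R gmult ?l (S x)) * cvec x)
        - (2 * real p * (x \<bullet> x) ^ p) *\<^sub>R (cvec x * S x)
        + (x \<bullet> x) ^ p *\<^sub>R (- (real CARD('n) + 2 * j + 2) *\<^sub>R (cvec x * S x) - gmult (mu CARD('n)) (S x) * cvec x)"
    unfolding even_term_def[abs_def] diff_Suc_1 dirac_add(2)[OF dG' dX']
      dirac_right_inner_power_scaleR[OF dG] dirac_right_inner_power_scaleR[OF dX]
      dirac_cvec_cvec_two_sided two_sided_polysD(3)[OF G] xx
    by (simp add: mult.commute)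
  also have "\<dots> = - (2 * real j + 2 * real p + 2 + real CARD('n)) *\<^sub>R odd_term p S x"
    unfolding lam odd_term_def by (simp add: algebra_simps)
  finally show "dirac_right (even_term j (Suc p) S) x = - (2 * real j + 2 * real p + 2 + real CARD('n)) *\<^sub>R odd_term p S x" .
qed

end

section \<open>Fischer decomposition\<close>

text \<open>Here \<open>j\<close> is the degree of \<open>S\<close> and \<open>j + n\<close> that of
  the term. The case \<open>n = 0\<close> is separate because \<open>even_term\<close> degenerates
  there.\<close>

definition fischer_term ::
  "nat \<Rightarrow> nat \<Rightarrow> (real^'n::{finite,linorder} \<Rightarrow> 'n clifford) \<Rightarrow> real^'n::{finite,linorder} \<Rightarrow> 'n clifford"
  where "fischer_term j n S =
    (if n = 0 then S else if odd n then odd_term (n div 2) S else even_term j (n div 2) S)"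

lemma homogeneous_fischer_term:
  assumes "homogeneous_polynomial j S"
  shows "homogeneous_polynomial (j + n) (fischer_term j n S)"
proof (cases "even n")
  case True
  then obtain p where "n = 2 * p" by blast
  with assms homogeneous_terms(2)[OF assms, of p] show ?thesis
    by (cases "p = 0") (auto simp: fischer_term_def)
next
  case False
  then obtain p where "n = Suc (2 * p)" by (metis oddE Suc_eq_plus1)
  with homogeneous_terms(1)[OF assms, of p] show ?thesis
    by (simp add: fischer_term_def)
qed

lemma gmult_const: "gmult (\<lambda>_. c) a = c *\<^sub>R a"
  by (rule clifford_eqI) simp

lemma gmult_scaleR: "gmult w (c *\<^sub>R a) = c *\<^sub>R gmult w a"
  by (rule clifford_eqI) simp

lemma odd_term_scaleR: "odd_term p (\<lambda>y. c *\<^sub>R S y) x = c *\<^sub>R odd_term p S x"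
  by (simp add: odd_term_def scaleR_add_right mult.commute)

lemma even_term_scaleR: "even_term j p (\<lambda>y. c *\<^sub>R S y) x = c *\<^sub>R even_term j p S x"
  by (simp add: even_term_def gmult_scaleR scaleR_add_right mult.commute)

text \<open>Locates the zeros of the factor in \<open>dirac_odd_term_0\<close>: for even
  \<open>l\<close> the equation reads \<open>l = m + j\<close>, and for odd \<open>l\<close> it
  reads \<open>l + j = 0\<close>, which is impossible.\<close>

lemma mu_eq_iff:
  assumes "l \<le> m" "mu m l = real m + 2 * real j" "m > 0"
  shows "l = m \<and> even m \<and> j = 0"
proof (cases "even l")
  case True
  with assms(2) have "real l = real (m + j)"
    by (simp add: mu_def)
  then have "l = m + j"
    by (simp only: of_nat_eq_iff)
  with True assms(1) show ?thesis by simp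
next
  case False
  with assms(2) have "real (l + j) = 0"
    by (simp add: mu_def)
  with False show ?thesis
    by (simp only: of_nat_eq_0_iff add_eq_0_iff_both_eq_0) simp
qed

text \<open>The only obstruction to inverting \<open>\<partial>\<close> on the terms is a pseudoscalar constant in even dimension, on
  which \<open>odd_term 0\<close> vanishes because the pseudoscalar anticommutes with vectors.\<close>

lemma dirac_fischer_term_surj:
  assumes S: "S \<in> two_sided_polys j"
    and top: "n = 0 \<Longrightarrow> j = 0 \<Longrightarrow> even CARD('n::{finite,linorder}) \<Longrightarrow> (\<And>x. coeff (S x) UNIV = 0)"
  shows "\<exists>S' \<in> two_sided_polys j. \<forall>x :: real^'n::{finite,linorder}.
    dirac_left (fischer_term j (Suc n) S') x = fischer_term j n S x \<and>
    dirac_right (fischer_term j (Suc n) S') x = fischer_term j n S x"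
proof (cases "even n")
  case True
  then obtain p where n: "n = 2 * p" by blast
  show ?thesis
  proof (cases p)
    case 0
    define v where "v l = mu CARD('n) l - real CARD('n) - 2 * real j" for l
    \<comment> \<open>Each grade is divided by its factor \<open>v l\<close>. Where
      \<open>v l = 0\<close>, division returns \<open>0\<close>, and \<open>top\<close> makes the
      affected coefficient of \<open>S\<close> vanish.\<close>
    let ?S = "\<lambda>y. gmult (\<lambda>l. 1 / v l) (S y)"
    have "gmult v (?S x) = S x" for x
    proof (rule clifford_eqI)
      fix A :: "'n set"
      have "coeff (S x) A = 0" if "v (card A) = 0"
      proof -
        have "card A = CARD('n) \<and> even CARD('n) \<and> j = 0"
          using that by (intro mu_eq_iff) (auto simp: v_def card_mono)
        moreover from this have "A = UNIV"
          by (simp add: card_eq_UNIV_imp_eq_UNIV)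
        ultimately show ?thesis
          using top n 0 by simp
      qed
      then show "coeff (gmult v (?S x)) A = coeff (S x) A"
        by (cases "v (card A) = 0") auto
    qed
    moreover have S': "?S \<in> two_sided_polys j"
      by (rule two_sided_polys_gmult[OF S])
    ultimately show ?thesis
      using dirac_odd_term_0[OF S'] n 0
      by (intro bexI[OF _ S']) (simp add: fischer_term_def v_def[abs_def])
  next
    case (Suc q)
    let ?S = "\<lambda>y. (1 / (2 * real (Suc q))) *\<^sub>R S y"
    have S': "?S \<in> two_sided_polys j"
      using two_sided_polys_gmult[OF S, of "\<lambda>_. 1 / (2 * real (Suc q))"] unfolding gmult_const .
    show ?thesis
      using dirac_odd_term[OF S', of q] n Suc
      by (intro bexI[OF _ S']) (simp add: fischer_term_def even_term_scaleR del: of_nat_Suc)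
  qed
next
  case False
  then obtain p where n: "n = Suc (2 * p)" by (metis oddE Suc_eq_plus1)
  let ?c = "- (2 * real j + 2 * real p + 2 + real CARD('n))"
  let ?S = "\<lambda>y. (1 / ?c) *\<^sub>R S y"
  have S': "?S \<in> two_sided_polys j"
    using two_sided_polys_gmult[OF S, of "\<lambda>_. 1 / ?c"] unfolding gmult_const .
  have "?c \<noteq> 0"
    using of_nat_0_le_iff[of j, where 'a = real] of_nat_0_le_iff[of p, where 'a = real]
      of_nat_0_le_iff[of "CARD('n)", where 'a = real] by linarith
  then have "dirac_left (even_term j (Suc p) ?S) x = odd_term p S x"
    "dirac_right (even_term j (Suc p) ?S) x = odd_term p S x" for x
    unfolding dirac_even_term[OF S'] odd_term_scaleR scaleR_scaleR by simp_all
  then show ?thesis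
    using n by (intro bexI[OF _ S']) (simp add: fischer_term_def)
qed

text \<open>\<open>P\<close> is generalized so that the induction applies to its derivative. Lifting
  raises \<open>n\<close> by one and replaces each component by one of the same degree, so only
  degree \<open>Suc k\<close> is left to be found.\<close>

lemma fischer_decomposition:
  fixes P :: "real^'n::{finite,linorder} \<Rightarrow> 'n clifford"
  assumes "homogeneous_polynomial k P" "\<And>x. dirac_left P x = dirac_right P x"
  shows "\<exists>S. (\<forall>n\<le>k. S n \<in> two_sided_polys n) \<and>
    (\<forall>x. P x = (\<Sum>n\<le>k. fischer_term (k - n) n (S (k - n)) x))"
  using assms
proof (induction k arbitrary: P)
  case 0
  then have "P \<in> two_sided_polys 0"
    by (simp add: left_monogenic_polys_def right_monogenic_polys_def homogeneous_0_dirac)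
  then show ?case
    by (intro exI[of _ "\<lambda>_. P"]) (simp add: fischer_term_def)
next
  case (Suc k)
  have pf: "polynomial_function P"
    using Suc.prems by (simp add: homogeneous_polynomial_def)
  define Q where "Q = dirac_left P"
  have QR: "Q = dirac_right P"
    using Suc.prems by (auto simp: Q_def)
  \<comment> \<open>Both descriptions of \<open>Q\<close> are used: \<open>\<partial>Q =
    \<partial>(P\<partial>) = (\<partial>P)\<partial> = Q\<partial>\<close>.\<close>
  have "dirac_left Q x = dirac_right Q x" for x
    using dirac_left_right_commute[OF pf] by (metis QR Q_def)
  moreover have "homogeneous_polynomial k Q"
    unfolding Q_def by (rule homogeneous_dirac(1)[OF Suc.prems(1)])
  ultimately obtain S where S: "\<And>n. n \<le> k \<Longrightarrow> S n \<in> two_sided_polys n"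
    and Q: "\<And>x. Q x = (\<Sum>n\<le>k. fischer_term (k - n) n (S (k - n)) x)"
    using Suc.IH by blast
  have "\<exists>S' \<in> two_sided_polys j. \<forall>x.
      dirac_left (fischer_term j (Suc (k - j)) S') x = fischer_term j (k - j) (S j) x \<and>
      dirac_right (fischer_term j (Suc (k - j)) S') x = fischer_term j (k - j) (S j) x" if "j \<le> k" for j
  proof (rule dirac_fischer_term_surj)
    show "S j \<in> two_sided_polys j"
      by (rule S[OF that])
    fix x
    \<comment> \<open>Here \<open>k = 0\<close>, so the expansion of \<open>Q\<close> is the single
      term \<open>S 0\<close>; its pseudoscalar coefficient vanishes because \<open>Q\<close> is
      both derivatives of \<open>P\<close>.\<close>
    assume "k - j = 0" "j = 0" "even CARD('n)"
    moreover from this have "S j x = Q x"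
      using Q[of x] by (simp add: fischer_term_def)
    ultimately show "coeff (S j x) UNIV = 0"
      using coeff_UNIV_dirac_left[of P x] Suc.prems(2) by (simp add: Q_def)
  qed
  then obtain S' where S': "\<And>j. j \<le> k \<Longrightarrow> S' j \<in> two_sided_polys j"
    and D: "\<And>j x. j \<le> k \<Longrightarrow> dirac_left (fischer_term j (Suc (k - j)) (S' j)) x = fischer_term j (k - j) (S j) x"
      "\<And>j x. j \<le> k \<Longrightarrow> dirac_right (fischer_term j (Suc (k - j)) (S' j)) x = fischer_term j (k - j) (S j) x"
    by metis
  define F where "F n = fischer_term (k - n) (Suc n) (S' (k - n))" for n
  have hF: "homogeneous_polynomial (Suc k) (F n)" if "n \<le> k" for n
    using homogeneous_fischer_term[OF two_sided_polysD(1)[OF S'[of "k - n"]], of "Suc n"] that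
    by (simp add: F_def)
  have DF: "dirac_left (F n) x = fischer_term (k - n) n (S (k - n)) x"
    "dirac_right (F n) x = fischer_term (k - n) n (S (k - n)) x" if "n \<le> k" for n x
    using D[of "k - n"] that by (simp_all add: F_def)
  \<comment> \<open>The lifted terms have total derivative \<open>Q\<close> on both sides, just like
    \<open>P\<close>, so this remainder is two-sided monogenic.\<close>
  define R where "R x = P x + (- 1) *\<^sub>R (\<Sum>n\<le>k. F n x)" for x
  have hsum: "homogeneous_polynomial (Suc k) (\<lambda>x. \<Sum>n\<le>k. F n x)"
    using hF by (intro homogeneous_sum) auto
  have hmin: "homogeneous_polynomial (Suc k) (\<lambda>x. (- 1) *\<^sub>R (\<Sum>n\<le>k. F n x))"
    by (rule homogeneous_linear_image[OF hsum bounded_linear_scaleR_right])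
  have "homogeneous_polynomial (Suc k) R"
    unfolding R_def[abs_def] by (rule homogeneous_add[OF Suc.prems(1) hmin])
  moreover have "dirac_left R x = 0" "dirac_right R x = 0" for x
  proof -
    note d = homogeneous_differentiable
    have "dirac_left (\<lambda>x. \<Sum>n\<le>k. F n x) x = Q x" "dirac_right (\<lambda>x. \<Sum>n\<le>k. F n x) x = Q x"
      by (subst dirac_sum, use d[OF hF] in \<open>auto simp: DF Q\<close>)+
    then show "dirac_left R x = 0" "dirac_right R x = 0"
      unfolding R_def[abs_def] dirac_add[OF d[OF Suc.prems(1)] d[OF hmin]] dirac_scaleR[OF d[OF hsum]]
      by (simp_all add: Q_def) (simp add: QR flip: Q_def)
  qed
  ultimately have R: "R \<in> two_sided_polys (Suc k)"
    by (simp add: left_monogenic_polys_def right_monogenic_polys_def)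
  \<comment> \<open>\<open>R\<close> takes the slot \<open>n = 0\<close>; shifting the index by one
    matches the other terms with \<open>F\<close>.\<close>
  let ?S = "S'(Suc k := R)"
  have "P x = (\<Sum>n\<le>Suc k. fischer_term (Suc k - n) n (?S (Suc k - n)) x)" for x
  proof -
    have "(\<Sum>n\<le>Suc k. fischer_term (Suc k - n) n (?S (Suc k - n)) x) = R x + (\<Sum>n\<le>k. F n x)"
      unfolding sum.atMost_Suc_shift by (auto simp: F_def fischer_term_def[of _ 0] intro!: sum.cong)
    then show ?thesis by (simp add: R_def)
  qed
  moreover have "\<forall>n\<le>Suc k. ?S n \<in> two_sided_polys n"
    using R S' by (auto simp: le_Suc_eq)
  ultimately show ?case by blast
qed

section \<open>Cauchy-Kowalevski extension\<close>

lemma polynomial_function_dirac_power: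
  assumes "polynomial_function f"
  shows "polynomial_function ((dirac_left ^^ n) f)"
  by (induction n) (auto simp: assms polynomial_function_dirac)

lemma homogeneous_dirac_power:
  assumes "homogeneous_polynomial k f"
  shows "n \<le> k \<Longrightarrow> homogeneous_polynomial (k - n) ((dirac_left ^^ n) f)"
    and "n > k \<Longrightarrow> (dirac_left ^^ n) f = (\<lambda>x. 0)"
proof (induction n)
  case 0
  { case 1 then show ?case by (simp add: assms) }
  { case 2 then show ?case by simp }
next
  case (Suc n)
  { case 1
    then have "homogeneous_polynomial (Suc (k - Suc n)) ((dirac_left ^^ n) f)"
      using Suc.IH(1) by (simp add: Suc_diff_Suc)
    then show ?case
      by (simp add: homogeneous_dirac) }
  { case 2
    show ?case
    proof (cases "n = k")
      case True
      with Suc.IH(1) show ?thesis by (simp add: homogeneous_0_dirac)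
    next
      case False
      with 2 Suc.IH(2) show ?thesis by simp
    qed }
qed

lemma CK_homogeneous:
  assumes "homogeneous_polynomial k f"
  shows "CK f t x = (\<Sum>n\<le>k. ((- t) ^ n / fact n) *\<^sub>R (dirac_left ^^ n) f x)"
  unfolding CK_def
  by (rule suminf_finite) (auto simp: homogeneous_dirac_power(2)[OF assms])

lemma dirac_power_sum:
  assumes "\<And>i. i \<in> I \<Longrightarrow> polynomial_function (f i)"
  shows "(dirac_left ^^ n) (\<lambda>y. \<Sum>i\<in>I. f i y) = (\<lambda>y. \<Sum>i\<in>I. (dirac_left ^^ n) (f i) y)"
proof (induction n)
  case (Suc n)
  have "dirac_left (\<lambda>y. \<Sum>i\<in>I. (dirac_left ^^ n) (f i) y) x = (\<Sum>i\<in>I. (dirac_left ^^ Suc n) (f i) x)" for x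
    by (subst dirac_sum)
      (simp_all add: differentiable_at_polynomial_function polynomial_function_dirac_power assms)
  then show ?case
    by (simp add: Suc.IH fun_eq_iff)
qed simp

text \<open>A common degree \<open>k\<close> truncates all the series at the same index, so only
  finite sums are exchanged.\<close>

lemma CK_sum:
  assumes "finite I" "\<And>i. i \<in> I \<Longrightarrow> homogeneous_polynomial k (f i)"
  shows "CK (\<lambda>y. \<Sum>i\<in>I. f i y) t x = (\<Sum>i\<in>I. CK (f i) t x)"
proof -
  have pf: "i \<in> I \<Longrightarrow> polynomial_function (f i)" for i
    using assms by (simp add: homogeneous_polynomial_def)
  have "CK (\<lambda>y. \<Sum>i\<in>I. f i y) t x
      = (\<Sum>n\<le>k. \<Sum>i\<in>I. ((- t) ^ n / fact n) *\<^sub>R (dirac_left ^^ n) (f i) x)"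
    by (simp add: CK_homogeneous[OF homogeneous_sum[OF assms]] dirac_power_sum[OF pf] scaleR_sum_right)
  then show ?thesis
    by (subst (asm) sum.swap) (simp add: CK_homogeneous[OF assms(2)])
qed

lemma CK_monogenic:
  assumes "\<And>x. dirac_left f x = 0"
  shows "CK f t x = f x"
proof -
  have "dirac_left f = (\<lambda>x. 0)"
    using assms by blast
  then have "(dirac_left ^^ Suc n) f = (\<lambda>x. 0)" for n
    by (induction n) auto
  then have "(dirac_left ^^ n) f = (\<lambda>x. 0)" if "n \<noteq> 0" for n
    using that not0_implies_Suc by blast
  then have "CK f t x = (\<Sum>n\<in>{0}. ((- t) ^ n / fact n) *\<^sub>R (dirac_left ^^ n) f x)"
    unfolding CK_def by (intro suminf_finite) auto
  then show ?thesis by simp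
qed

text \<open>Regroups a polynomial by powers of \<open>x0\<close>. The bound on the degree is uniform
  in \<open>x\<close>, which allows one finite sum valid at all points; a linear \<open>f\<close>
  splits as \<open>f (0, x) + t * f (1, 0)\<close>.\<close>

lemma real_polynomial_function_Pair_expand:
  fixes f :: "real \<times> 'a::euclidean_space \<Rightarrow> real"
  assumes "real_polynomial_function f"
  shows "\<exists>q N. (\<forall>i. real_polynomial_function (\<lambda>x. Polynomial.coeff (q x) i)) \<and>
    (\<forall>x. degree (q x) \<le> N) \<and> (\<forall>t x. f (t, x) = poly (q x) t)"
  using assms
proof induction
  case (linear f)
  note bl = linear
  from linear interpret bounded_linear f .
  have "bounded_linear (\<lambda>x. f (0, x))"
    using bounded_linear_compose[OF bl bounded_linear_Pair[OF bounded_linear_zero bounded_linear_ident]] .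
  then have "real_polynomial_function (\<lambda>x. Polynomial.coeff [: f (0, x), f (1, 0) :] i)" for i
  proof (cases i)
    case 0
    with \<open>bounded_linear (\<lambda>x. f (0, x))\<close> show ?thesis
      by (simp add: real_polynomial_function.intros(1))
  next
    case (Suc k)
    then show ?thesis
      by (cases k) (simp_all add: real_polynomial_function.intros(2))
  qed
  moreover have "f (t, x) = poly [: f (0, x), f (1, 0) :] t" for t x
  proof -
    have "(t, x) = (0, x) + t *\<^sub>R (1, 0)" by simp
    then show ?thesis by (simp only: add scaleR) simp
  qed
  moreover have "degree [: f (0, x), f (1, 0) :] \<le> 1" for x
    by (simp add: degree_pCons_le)
  ultimately show ?case
    by (intro exI[of _ "\<lambda>x. [: f (0, x), f (1, 0) :]"] exI[of _ 1] conjI allI)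
next
  case (const c)
  show ?case
    by (intro exI[of _ "\<lambda>x. [: c :]"] exI[of _ 0]) (auto intro: real_polynomial_function.intros(2))
next
  case (add f g)
  then obtain q N r N' where
    *: "\<And>i. real_polynomial_function (\<lambda>x. Polynomial.coeff (q x) i)" "\<And>x. degree (q x) \<le> N"
    "\<And>t x. f (t, x) = poly (q x) t"
    "\<And>i. real_polynomial_function (\<lambda>x. Polynomial.coeff (r x) i)" "\<And>x. degree (r x) \<le> N'"
    "\<And>t x. g (t, x) = poly (r x) t"
    by blast
  have "degree (q x + r x) \<le> max N N'" for x
    using *(2,5) by (intro degree_add_le) (auto intro: max.coboundedI1 max.coboundedI2)
  with * show ?case
    by (intro exI[of _ "\<lambda>x. q x + r x"] exI[of _ "max N N'"])
      (auto intro!: real_polynomial_function.intros(3))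
next
  case (mult f g)
  then obtain q N r N' where
    *: "\<And>i. real_polynomial_function (\<lambda>x. Polynomial.coeff (q x) i)" "\<And>x. degree (q x) \<le> N"
    "\<And>t x. f (t, x) = poly (q x) t"
    "\<And>i. real_polynomial_function (\<lambda>x. Polynomial.coeff (r x) i)" "\<And>x. degree (r x) \<le> N'"
    "\<And>t x. g (t, x) = poly (r x) t"
    by blast
  have "degree (q x * r x) \<le> N + N'" for x
    using degree_mult_le[of "q x" "r x"] *(2,5) by (meson add_mono order_trans)
  with * show ?case
    by (intro exI[of _ "\<lambda>x. q x * r x"] exI[of _ "N + N'"])
      (auto intro!: real_polynomial_function_sum real_polynomial_function.intros(4) simp: coeff_mult)
qed

lemma polynomial_function_Pair_expand:
  fixes f :: "real \<times> 'a::euclidean_space \<Rightarrow> 'n::finite clifford"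
  assumes "polynomial_function f"
  shows "\<exists>Q N. (\<forall>i. polynomial_function (Q i)) \<and> (\<forall>i>N. Q i = (\<lambda>x. 0)) \<and>
    (\<forall>t x. f (t, x) = (\<Sum>i\<le>N. t ^ i *\<^sub>R Q i x))"
proof -
  have "\<exists>q N. (\<forall>i. real_polynomial_function (\<lambda>x. Polynomial.coeff (q x) i)) \<and>
    (\<forall>x. degree (q x) \<le> N) \<and> (\<forall>t x. coeff (f (t, x)) A = poly (q x) t)" for A
    using assms by (intro real_polynomial_function_Pair_expand) (simp add: polynomial_function_clifford_iff)
  then obtain q N where q: "\<And>A i. real_polynomial_function (\<lambda>x. Polynomial.coeff (q A x) i)"
    "\<And>A x. degree (q A x) \<le> N A" "\<And>A t x. coeff (f (t, x)) A = poly (q A x) t"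
    by metis
  define Q where "Q i x = Abs_clifford (\<lambda>A. Polynomial.coeff (q A x) i)" for i x
  define N' where "N' = Max (range N)"
  have deg: "degree (q A x) \<le> N'" for A x
    unfolding N'_def by (rule order_trans[OF q(2) Max_ge]) auto
  have "polynomial_function (Q i)" for i
    by (simp add: polynomial_function_clifford_iff Q_def q(1))
  moreover have "Q i = (\<lambda>x. 0)" if "i > N'" for i
  proof
    fix x
    have "Polynomial.coeff (q A x) i = 0" for A
      by (rule coeff_eq_0[OF order.strict_trans1[OF deg that]])
    then show "Q i x = 0"
      by (simp add: Q_def clifford_eq_iff)
  qed
  moreover have "f (t, x) = (\<Sum>i\<le>N'. t ^ i *\<^sub>R Q i x)" for t x
  proof (rule clifford_eqI)
    fix A
    have "poly (q A x) t = poly (\<Sum>i\<le>N'. Polynomial.monom (Polynomial.coeff (q A x) i) i) t"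
      by (simp only: poly_as_sum_of_monoms'[OF deg])
    then show "coeff (f (t, x)) A = coeff (\<Sum>i\<le>N'. t ^ i *\<^sub>R Q i x) A"
      by (simp add: q(3) Q_def poly_sum poly_monom mult.commute)
  qed
  ultimately show ?thesis by blast
qed

lemma clifford_power_sum_eq_0:
  fixes c :: "nat \<Rightarrow> 'n clifford"
  assumes "\<And>t :: real. (\<Sum>i\<le>N. t ^ i *\<^sub>R c i) = 0" "i \<le> N"
  shows "c i = 0"
proof (rule clifford_eqI)
  fix A
  have "(\<Sum>i\<le>N. coeff (c i) A * t ^ i) = 0" for t :: real
    using arg_cong[OF assms(1), of "\<lambda>a. coeff a A" t] by (simp add: mult.commute)
  then show "coeff (c i) A = coeff 0 A"
    using assms(2) Transcendental.polyfun_eq_0[of "\<lambda>i. coeff (c i) A" N] by simp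
qed

text \<open>Uniqueness of the extension: comparing powers of \<open>x0\<close> gives
  \<open>(i + 1) Q_(i+1) = - \<partial>Q_i\<close>, so every coefficient is determined by
  \<open>Q 0\<close>, the restriction to \<open>x0 = 0\<close>.\<close>

lemma left_monogenic_polynomial_eq_CK:
  fixes M :: "real \<times> (real^'n::{finite,linorder}) \<Rightarrow> 'n clifford"
  assumes pf: "polynomial_function M" and mono: "left_monogenic_on UNIV M"
  shows "M (t, x) = CK (\<lambda>y. M (0, y)) t x"
proof -
  obtain Q N where Q: "\<And>i. polynomial_function (Q i)" "\<And>i. i > N \<Longrightarrow> Q i = (\<lambda>x. 0)"
    and M: "\<And>t x. M (t, x) = (\<Sum>i\<le>N. t ^ i *\<^sub>R Q i x)"
    using polynomial_function_Pair_expand[OF pf] by metis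
  note d = differentiable_at_polynomial_function[OF Q(1)]
  have rec: "dirac_left (Q i) = (\<lambda>x. - real (Suc i) *\<^sub>R Q (Suc i) x)" for i
  proof (cases "i \<le> N")
    case True
    show ?thesis
    proof
      fix x
      have "(\<Sum>i\<le>N. t ^ i *\<^sub>R (real (Suc i) *\<^sub>R Q (Suc i) x + dirac_left (Q i) x)) = 0" for t
      proof -
        have "((\<lambda>s. M (s, x)) has_vector_derivative (\<Sum>i\<le>N. (real i * t ^ (i - 1)) *\<^sub>R Q i x)) (at t)"
          unfolding M
          by (intro has_vector_derivative_sum)
            (auto intro!: derivative_eq_intros simp: has_vector_derivative_def)
        then have "vector_derivative (\<lambda>s. M (s, x)) (at t) = (\<Sum>i\<le>N. (real i * t ^ (i - 1)) *\<^sub>R Q i x)"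
          by (rule vector_derivative_at)
        \<comment> \<open>Appending the vanishing term at \<open>Suc N\<close> makes the shifted sum
          end at \<open>N\<close>; its first term drops out through the factor
          \<open>real i\<close>.\<close>
        also have "\<dots> = (\<Sum>i\<le>Suc N. (real i * t ^ (i - 1)) *\<^sub>R Q i x)"
          by (simp add: Q(2))
        also have "\<dots> = (\<Sum>i\<le>N. t ^ i *\<^sub>R (real (Suc i) *\<^sub>R Q (Suc i) x))"
          unfolding sum.atMost_Suc_shift by (simp add: mult.commute)
        finally have "vector_derivative (\<lambda>s. M (s, x)) (at t)
          = (\<Sum>i\<le>N. t ^ i *\<^sub>R (real (Suc i) *\<^sub>R Q (Suc i) x))" .
        moreover have "dirac_left (\<lambda>y. M (t, y)) x = (\<Sum>i\<le>N. t ^ i *\<^sub>R dirac_left (Q i) x)"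
          unfolding M
          by (subst dirac_sum)
            (simp_all only: dirac_scaleR[OF d] differentiable_scaleR[OF differentiable_const d])
        moreover have "vector_derivative (\<lambda>s. M (s, x)) (at t) + dirac_left (\<lambda>y. M (t, y)) x = 0"
          using mono by (auto simp: left_monogenic_on_def)
        ultimately show ?thesis
          by (simp add: scaleR_add_right sum.distrib)
      qed
      then have "real (Suc i) *\<^sub>R Q (Suc i) x + dirac_left (Q i) x = 0"
        using clifford_power_sum_eq_0[where N = N and i = i
            and c = "\<lambda>i. real (Suc i) *\<^sub>R Q (Suc i) x + dirac_left (Q i) x"] True
        by blast
      then show "dirac_left (Q i) x = - real (Suc i) *\<^sub>R Q (Suc i) x"
        by (simp only: scaleR_minus_left eq_neg_iff_add_eq_0 add.commute)
    qed
  next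
    case False
    then show ?thesis by (simp add: Q(2))
  qed
  have pow: "(dirac_left ^^ n) (Q 0) = (\<lambda>x. ((- 1) ^ n * fact n) *\<^sub>R Q n x)" for n
  proof (induction n)
    case (Suc n)
    have "(dirac_left ^^ Suc n) (Q 0) = dirac_left (\<lambda>x. ((- 1) ^ n * fact n) *\<^sub>R Q n x)"
      by (simp add: Suc.IH)
    then show ?case
      by (simp add: dirac_scaleR d rec fun_eq_iff algebra_simps)
  qed simp
  have "CK (Q 0) t x = (\<Sum>n. t ^ n *\<^sub>R Q n x)"
  proof -
    have "(- t) ^ n * (- 1) ^ n = t ^ n" for n
      by (simp flip: power_mult_distrib)
    then show ?thesis
      by (simp add: CK_def pow)
  qed
  also have "\<dots> = (\<Sum>n\<le>N. t ^ n *\<^sub>R Q n x)"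
    by (rule suminf_finite) (auto simp: Q(2))
  finally have "CK (Q 0) t x = M (t, x)"
    by (simp add: M)
  moreover have "(\<lambda>y. M (0, y)) = Q 0"
    by (simp add: M fun_eq_iff sum.atMost_shift)
  ultimately show ?thesis by simp
qed

section \<open>The terms rewritten with norms and projections\<close>

lemma inner_power_eq_norm: "(y \<bullet> y) ^ p = norm y ^ (2 * p)"
  by (simp add: power_mult power2_norm_eq_inner)

lemma fischer_term_odd:
  assumes "odd n"
  shows "fischer_term j n S = (\<lambda>y. norm y ^ (n - 1) *\<^sub>R (cvec y * S y + S y * cvec y))"
  using assms
  by (auto simp: fischer_term_def odd_term_def fun_eq_iff inner_power_eq_norm elim: oddE)

text \<open>The sandwiches of the separate grades add up by linearity and \<open>sum_grade\<close>,
  while the \<open>lam\<close> summands are the grade expansion of \<open>gmult\<close>.\<close>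

lemma fischer_term_even:
  fixes S :: "real^'n::{finite,linorder} \<Rightarrow> 'n clifford"
  assumes "even n" "n > 0"
  shows "fischer_term j n S = (\<lambda>y. \<Sum>l = 0..CARD('n).
    (lam CARD('n) (j + n) n l * norm y ^ n) *\<^sub>R grade l (S y)
      + norm y ^ (n - 2) *\<^sub>R (cvec y * grade l (S y) * cvec y))"
proof
  fix y
  obtain p where n: "n = 2 * p" and p: "p > 0"
    using assms by auto
  have "2 * (p - 1) = n - 2"
    using n by simp
  have "(\<Sum>l = 0..CARD('n). cvec y * grade l (S y) * cvec y) = cvec y * S y * cvec y"
    using sum_grade[of "S y"] by (simp add: atLeast0AtMost flip: sum_distrib_left sum_distrib_right)
  then have sandwich: "(\<Sum>l = 0..CARD('n). norm y ^ (n - 2) *\<^sub>R (cvec y * grade l (S y) * cvec y))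
      = norm y ^ (n - 2) *\<^sub>R (cvec y * S y * cvec y)"
    by (simp flip: scaleR_sum_right)
  have diag: "(\<Sum>l = 0..CARD('n). (lam CARD('n) (j + n) n l * norm y ^ n) *\<^sub>R grade l (S y))
      = norm y ^ n *\<^sub>R gmult (lam CARD('n) (j + n) n) (S y)"
    unfolding gmult_eq_sum_grade scaleR_sum_right by (simp add: mult.commute)
  show "fischer_term j n S y = (\<Sum>l = 0..CARD('n).
    (lam CARD('n) (j + n) n l * norm y ^ n) *\<^sub>R grade l (S y)
      + norm y ^ (n - 2) *\<^sub>R (cvec y * grade l (S y) * cvec y))"
    unfolding sum.distrib sandwich diag using n p \<open>2 * (p - 1) = n - 2\<close>
    by (simp add: fischer_term_def even_term_def inner_power_eq_norm)
qed

text \<open>The extension is applied grade by grade, so \<open>CK_sum\<close> needs homogeneity of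
  each summand, not just of their sum.\<close>

lemma homogeneous_even_summand:
  fixes S :: "real^'n::{finite,linorder} \<Rightarrow> 'n clifford"
  assumes "homogeneous_polynomial j S" "even n" "n > 0"
  shows "homogeneous_polynomial (j + n) (\<lambda>y. (c * norm y ^ n) *\<^sub>R grade l (S y)
      + norm y ^ (n - 2) *\<^sub>R (cvec y * grade l (S y) * cvec y))"
proof -
  obtain q where n: "n = 2 * Suc q"
    using assms(2,3) by (metis evenE gr0_implies_Suc mult_is_0 neq0_conv)
  note ct = homogeneous_clifford_times
  let ?w = "\<lambda>i. if i = l then 1 else 0 :: real"
  have g: "homogeneous_polynomial j (\<lambda>y. gmult ?w (S y))"
    by (rule homogeneous_linear_image[OF assms(1) bounded_linear_gmult])
  have "homogeneous_polynomial (j + n) (\<lambda>y. c *\<^sub>R (norm y ^ n *\<^sub>R gmult ?w (S y)))"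
    using homogeneous_linear_image[OF homogeneous_inner_power_scaleR[OF g, of "Suc q"]
        bounded_linear_scaleR_right[of c]]
    unfolding inner_power_eq_norm by (simp add: n add.commute)
  moreover have "homogeneous_polynomial (j + n)
      (\<lambda>y. norm y ^ (n - 2) *\<^sub>R (cvec y * gmult ?w (S y) * cvec y))"
    using homogeneous_inner_power_scaleR[OF ct[OF ct[OF homogeneous_cvec g] homogeneous_cvec], of q]
    unfolding inner_power_eq_norm by (simp add: n add.commute)
  ultimately show ?thesis
    using homogeneous_add by (fastforce simp: grade_eq_gmult)
qed

theorem theorem3:
  fixes k :: nat
    and M :: "real \<times> (real^'n::{finite,linorder}) \<Rightarrow> 'n clifford"
  assumes "homogeneous_polynomial k M"
    and "two_sided_monogenic_on UNIV M"
  shows "\<exists>S :: nat \<Rightarrow> real^'n::{finite,linorder} \<Rightarrow> 'n clifford.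
    (\<forall>n\<le>k. S n \<in> left_monogenic_polys n \<inter> right_monogenic_polys n) \<and>
    (\<forall>x0 x. M (x0, x) =
      S k x
      + (\<Sum>n | n \<in> {1..k} \<and> odd n.
          CK (\<lambda>y. norm y ^ (n - 1) *\<^sub>R (cvec y * S (k - n) y + S (k - n) y * cvec y)) x0 x)
      + (\<Sum>n | n \<in> {2..k} \<and> even n. \<Sum>l = 0..CARD('n).
          CK (\<lambda>y. (lam CARD('n) k n l * norm y ^ n) *\<^sub>R grade l (S (k - n) y)
                 + norm y ^ (n - 2) *\<^sub>R (cvec y * grade l (S (k - n) y) * cvec y)) x0 x))"
proof -
  let ?P = "\<lambda>x. M (0, x)"
  have pf: "polynomial_function M"
    using assms(1) by (simp add: homogeneous_polynomial_def)
  have "bounded_linear (\<lambda>x :: real^'n::{finite,linorder}. (0 :: real, x))"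
    by (intro bounded_linear_Pair bounded_linear_zero bounded_linear_ident)
  from polynomial_function_compose[OF polynomial_function_bounded_linear[OF this] pf]
  have "polynomial_function ?P"
    by (simp add: o_def)
  moreover have "M (0, c *\<^sub>R x) = c ^ k *\<^sub>R M (0, x)" for c x
    using assms(1) unfolding homogeneous_polynomial_def by (metis scaleR_Pair scaleR_zero_right)
  ultimately have hP: "homogeneous_polynomial k ?P"
    by (simp add: homogeneous_polynomial_def)
  \<comment> \<open>Comparing the two monogenicity equations at \<open>x0 = 0\<close> eliminates the
    \<open>x0\<close>-derivative.\<close>
  have "dirac_left ?P x = dirac_right ?P x" for x
  proof -
    have "vector_derivative (\<lambda>t. M (t, x)) (at 0) + dirac_left ?P x = 0"
      "vector_derivative (\<lambda>t. M (t, x)) (at 0) + dirac_right ?P x = 0"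
      using assms(2)
      by (auto simp: two_sided_monogenic_on_def left_monogenic_on_def right_monogenic_on_def)
    then show ?thesis by (metis add_left_cancel)
  qed
  from fischer_decomposition[OF hP this] obtain S
    where S: "\<And>n. n \<le> k \<Longrightarrow> S n \<in> two_sided_polys n"
      and P: "\<And>x. ?P x = (\<Sum>n\<le>k. fischer_term (k - n) n (S (k - n)) x)"
    by blast
  define T where "T n = fischer_term (k - n) n (S (k - n))" for n
  have hS: "homogeneous_polynomial (k - n) (S (k - n))" for n
    using two_sided_polysD(1)[OF S] by simp
  have hT: "homogeneous_polynomial k (T n)" if "n \<le> k" for n
    using homogeneous_fischer_term[OF hS[of n], of n] that by (simp add: T_def)
  have even: "CK (T n) x0 x = (\<Sum>l = 0..CARD('n).
      CK (\<lambda>y. (lam CARD('n) k n l * norm y ^ n) *\<^sub>R grade l (S (k - n) y)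
        + norm y ^ (n - 2) *\<^sub>R (cvec y * grade l (S (k - n) y) * cvec y)) x0 x)"
    if "n \<in> {2..k}" "even n" for n x0 x
  proof -
    have n: "n > 0" "k - n + n = k"
      using that by auto
    show ?thesis
      unfolding T_def fischer_term_even[OF that(2) n(1)] n(2)
      using homogeneous_even_summand[OF hS[of n] that(2) n(1), unfolded n(2)]
      by (intro CK_sum[where k = k]) simp_all
  qed
  have "M (x0, x) = S k x + (\<Sum>n | n \<in> {1..k} \<and> odd n. CK (T n) x0 x)
      + (\<Sum>n | n \<in> {2..k} \<and> even n. CK (T n) x0 x)" for x0 x
  proof -
    let ?O = "{n. n \<in> {1..k} \<and> odd n}" and ?E = "{n. n \<in> {2..k} \<and> even n}"
    have fin: "finite ?O" "finite ?E" and disj: "?O \<inter> ?E = {}" and zero: "0 \<notin> ?O \<union> ?E"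
      by auto
    have "M (x0, x) = CK ?P x0 x"
      using assms(2) unfolding two_sided_monogenic_on_def
      by (intro left_monogenic_polynomial_eq_CK[OF pf]) (rule conjunct1)
    also have "?P = (\<lambda>y. \<Sum>n\<le>k. T n y)"
      unfolding T_def by (rule ext) (rule P)
    also have "CK \<dots> x0 x = (\<Sum>n\<le>k. CK (T n) x0 x)"
      by (rule CK_sum[where k = k]) (simp_all add: hT)
    \<comment> \<open>The index \<open>n = 0\<close> belongs to neither sum of the statement; it
      carries \<open>S k\<close>, whose extension does not depend on \<open>x0\<close>.\<close>
    also have "{..k} = insert 0 (?O \<union> ?E)"
    proof -
      have "n \<ge> 2" if "n \<noteq> 0" "even n" for n :: nat
        using that by (cases "n = 1") auto
      then show ?thesis
        by (auto simp: Suc_le_eq)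
    qed
    also have "(\<Sum>n\<in>insert 0 (?O \<union> ?E). CK (T n) x0 x)
        = CK (T 0) x0 x + ((\<Sum>n\<in>?O. CK (T n) x0 x) + (\<Sum>n\<in>?E. CK (T n) x0 x))"
      using sum.insert[OF finite_UnI[OF fin] zero] sum.union_disjoint[OF fin disj] by simp
    also have "CK (T 0) x0 x = S k x"
      using CK_monogenic[of "S k"] two_sided_polysD(2)[OF S[of k]] by (simp add: T_def fischer_term_def)
    finally show ?thesis by (simp add: add.assoc)
  qed
  moreover have "(\<Sum>n | n \<in> {1..k} \<and> odd n. CK (T n) x0 x) = (\<Sum>n | n \<in> {1..k} \<and> odd n.
      CK (\<lambda>y. norm y ^ (n - 1) *\<^sub>R (cvec y * S (k - n) y + S (k - n) y * cvec y)) x0 x)" for x0 x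
    by (rule sum.cong) (simp_all only: mem_Collect_eq T_def fischer_term_odd simp_thms)
  moreover have "(\<Sum>n | n \<in> {2..k} \<and> even n. CK (T n) x0 x) = (\<Sum>n | n \<in> {2..k} \<and> even n. \<Sum>l = 0..CARD('n).
      CK (\<lambda>y. (lam CARD('n) k n l * norm y ^ n) *\<^sub>R grade l (S (k - n) y)
        + norm y ^ (n - 2) *\<^sub>R (cvec y * grade l (S (k - n) y) * cvec y)) x0 x)" for x0 x
    by (rule sum.cong) (simp_all only: mem_Collect_eq even)
  ultimately show ?thesis
    using S by (intro exI[of _ S] conjI allI impI) (simp_all only:)
qed

end
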